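(* Let $q$ be a prime power and $h$ a positive integer. (1) Let $X$ be regular of pointed type in $\mathrm{PG}(2,q^h)$, let $\mathcal{C}(X)$ denote the associated projective code, and let $e_i$ be the coefficient of $x^i$ in the intersection enumerator $\iota(x)$ of $X$. Then the weight enumerator $1+(q^h-1)\sum_i e_ix^{|X|-i}$ of $\mathcal{C}(X)$ modulo $q^h$ equals $$1-x^{|X|-1}.$$ (2) If $h=2$ and $X$ is the set of projective points in $\mathrm{PG}(2,q^2)$ of the curve of affine equation $\mathrm{Tr}(y+f(x))=\mathrm{N}(x)$ for some additive function $f:\mathrm{GF}(q^2)\to\mathrm{GF}(q^2)$, then the weight enumerator of $\mathcal{C}(X)$ modulo $q^3$ equals $$1-q^2x^{q^3-q}+(q^2-1)x^{q^3}.$$ (3) Let $S\subseteq\mathrm{AG}(2,q)$ be such that $S\cup\{(\infty)\}$ is regular of pointed type $[t;m_1,\ldots,m_g]$ in $\mathrm{PG}(2,q)$, let $I$ be a non-trivial $s$-dimensional $\mathrm{GF}(q)$-subspace of $\mathrm{GF}(q^h)$ with $I\cap\mathrm{GF}(q)=\{0\}$, let $S'=\{(x,y+i): i\in I,\ (x,y)\in S\}\subseteq\mathrm{AG}(2,q^h)$ and $X=S'\cup\{(\infty)\}\subseteq \mathrm{PG}(2,q^h)$. Then the weight enumerator of $\mathcal{C}(X)$ modulo $q^{2s+1}$ equals $$1+(q^{h+1}-q)x^{tq^s(q-1)}+(-q^{h+1}+q-1)x^{tq^{s+1}}.$$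
   Context: Equality of polynomials modulo $n$ means coefficientwise congruence modulo $n$. Geometry. For a prime power $Q$, $\mathrm{AG}(2,Q)$ is $\mathrm{PG}(2,Q)$ minus the line at infinity $\ell_\infty$; $(\infty)=(0:1:0)\in\ell_\infty$ is the common ideal point of the vertical lines $x=\alpha$. A line is a $k$-secant of a point set $X$ if it meets $X$ in exactly $k$ points. A point set $X$ of $\mathrm{PG}(2,Q)$ is regular of pointed type $[t;m_1,\ldots,m_g]$, where $t>0$, if there are a distinguished point $P_0\in X$ and a line $\ell_0$ with $\ell_0\cap X=\{P_0\}$ such that: (i) every line not through $P_0$ is an $m_i$-secant of $X$ for some $i$; (ii) for each $i$, the number of $m_i$-secants incident with $P$ is the same for each $P\in\ell_0\setminus\{P_0\}$; (iii) all lines incident with $P_0$ other than $\ell_0$ are $(t+1)$-secants of $X$. "Regular of pointed type" means this for some parameters. In (3) the distinguished point of $S\cup\{(\infty)\}$ is $(\infty)$ with tangent $\ell_\infty$. In (2), $\mathrm{Tr}(x)=x+x^q$ and $\mathrm{N}(x)=x^{q+1}$, and the projective points of the curve are the affine points $(x,y)\in\mathrm{GF}(q^2)^2$ satisfying the equation together with the only point at infinity $(\infty)$. Codes. For a point set $X$ of $\mathrm{PG}(2,Q)$, the projective code $\mathcal{C}(X)$ is the linear code over $\mathrm{GF}(Q)$ of length $|X|$ with generator matrix the $3\times|X|$ matrix whose columns are coordinate vectors of the points of $X$ (in any order). The intersection enumerator of $X$ is $\iota(x)=\sum_{\ell}x^{|\ell\cap X|}=\sum_ie_ix^i$, the sum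 being over all lines $\ell$ of $\mathrm{PG}(2,Q)$. The weight enumerator of a code is $1+\sum_{i\geq1}A_ix^i$, where $A_i$ is the number of codewords of Hamming weight $i$. *)

theory Defs
  imports
    "HOL-Analysis.Analysis"
    "HOL-Computational_Algebra.Polynomial"
    "HOL-Number_Theory.Cong"
    "HOL-Number_Theory.Prime_Powers"
begin

definition poly_cong :: "int \<Rightarrow> int poly \<Rightarrow> int poly \<Rightarrow> bool" where
  "poly_cong n p r \<longleftrightarrow> (\<forall>i. [coeff p i = coeff r i] (mod n))"

text \<open>
  The plane \<open>PG(2,Q)\<close> is rendered over a field type with \<open>Q\<close> elements.  Its points are
  the one-dimensional subspaces of the space of coordinate triples; a line is the set of
  all points contained in a two-dimensional subspace, so that incidence is membership and
  \<open>\<ell> \<inter> X\<close> is a literal intersection.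
\<close>

definition pg_points :: "('a::field ^ 3) set set" where
  "pg_points = {P. vec.subspace P \<and> vec.dim P = 1}"

definition pg_lines :: "('a::field ^ 3) set set set" where
  "pg_lines = {{P \<in> pg_points. P \<subseteq> W} | W. vec.subspace W \<and> vec.dim W = 2}"

definition pg_point :: "'a::field \<Rightarrow> 'a \<Rightarrow> 'a \<Rightarrow> ('a ^ 3) set" where
  "pg_point x y z = vec.span {vector [x, y, z]}"

text \<open>
  The line at infinity is \<open>z = 0\<close>, and the affine point \<open>(x, y)\<close> is \<open>(x : y : 1)\<close>; thus
  \<open>(0 : 1 : 0)\<close> is the common ideal point of the lines \<open>x = \<alpha>\<close>.
\<close>

definition affine_point :: "'a::field \<times> 'a \<Rightarrow> ('a ^ 3) set" where
  "affine_point = (\<lambda>(x, y). pg_point x y 1)"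

definition point_infinity :: "('a::field ^ 3) set" where
  "point_infinity = pg_point 0 1 0"

definition line_infinity :: "('a::field ^ 3) set set" where
  "line_infinity = {P \<in> pg_points. \<forall>v\<in>P. v $ 3 = 0}"

definition is_secant :: "nat \<Rightarrow> ('a::field ^ 3) set set \<Rightarrow> ('a ^ 3) set set \<Rightarrow> bool" where
  "is_secant k X l \<longleftrightarrow> l \<in> pg_lines \<and> finite (l \<inter> X) \<and> card (l \<inter> X) = k"

definition regular_pointed_at ::
    "('a::field ^ 3) set \<Rightarrow> ('a ^ 3) set set \<Rightarrow> nat \<Rightarrow> nat list \<Rightarrow> ('a ^ 3) set set \<Rightarrow> bool" where
  "regular_pointed_at P0 l0 t ms X \<longleftrightarrow>
     X \<subseteq> pg_points \<and> t > 0 \<and> P0 \<in> X \<and> l0 \<in> pg_lines \<and> l0 \<inter> X = {P0} \<and>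
     (\<forall>l\<in>pg_lines. P0 \<notin> l \<longrightarrow> (\<exists>m\<in>set ms. is_secant m X l)) \<and>
     (\<forall>m\<in>set ms. \<forall>P\<in>l0 - {P0}. \<forall>R\<in>l0 - {P0}.
        card {l. is_secant m X l \<and> P \<in> l} = card {l. is_secant m X l \<and> R \<in> l}) \<and>
     (\<forall>l\<in>pg_lines. P0 \<in> l \<and> l \<noteq> l0 \<longrightarrow> is_secant (t + 1) X l)"

definition regular_pointed :: "('a::field ^ 3) set set \<Rightarrow> bool" where
  "regular_pointed X \<longleftrightarrow> (\<exists>P0 l0 t ms. regular_pointed_at P0 l0 t ms X)"

definition intersection_enumerator :: "('a::{field,finite} ^ 3) set set \<Rightarrow> int poly" where
  "intersection_enumerator X = (\<Sum>l\<in>pg_lines. monom 1 (card (l \<inter> X)))"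

text \<open>
  A word of length \<open>n\<close> is a list of length \<open>n\<close>, and a matrix with \<open>k\<close> rows and \<open>n\<close> columns
  is given by the list of its columns.  The words below are the linear combinations of the
  rows, \<open>u\<close> being the vector of coefficients.
\<close>

definition code_generated_by :: "('a::field ^ 'k) list \<Rightarrow> 'a list set" where
  "code_generated_by cols = {map (\<lambda>c. \<Sum>i\<in>UNIV. u $ i * c $ i) cols | u. True}"

text \<open>
  Since the order of the points and their coordinate vectors may be chosen freely, being
  a projective code of \<open>X\<close> is a relation.
\<close>

definition is_projective_code :: "('a::field ^ 3) set set \<Rightarrow> 'a list set \<Rightarrow> bool" where
  "is_projective_code X C \<longleftrightarrow>
     (\<exists>cols. distinct (map (\<lambda>c. vec.span {c}) cols) \<and> set (map (\<lambda>c. vec.span {c}) cols) = X \<and>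
             C = code_generated_by cols)"

definition hamming_weight :: "'a::zero list \<Rightarrow> nat" where
  "hamming_weight c = card {i. i < length c \<and> c ! i \<noteq> 0}"

definition weight_enumerator :: "nat \<Rightarrow> 'a::zero list set \<Rightarrow> int poly" where
  "weight_enumerator n C = 1 + (\<Sum>i = 1..n. monom (int (card {c \<in> C. hamming_weight c = i})) i)"

definition is_field_embedding :: "('k::field \<Rightarrow> 'a::field) \<Rightarrow> bool" where
  "is_field_embedding \<phi> \<longleftrightarrow>
     \<phi> 1 = 1 \<and> (\<forall>a b. \<phi> (a + b) = \<phi> a + \<phi> b) \<and> (\<forall>a b. \<phi> (a * b) = \<phi> a * \<phi> b)"

definition rel_trace :: "nat \<Rightarrow> 'a::field \<Rightarrow> 'a" where
  "rel_trace q x = x + x ^ q"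

definition rel_norm :: "nat \<Rightarrow> 'a::field \<Rightarrow> 'a" where
  "rel_norm q x = x ^ (q + 1)"

definition curve_points :: "nat \<Rightarrow> ('a::field \<Rightarrow> 'a) \<Rightarrow> ('a ^ 3) set set" where
  "curve_points q f =
     insert point_infinity (affine_point ` {(x, y). rel_trace q (y + f x) = rel_norm q x})"

text \<open>
  The smaller field \<open>GF(q)\<close> is a type of its own, identified with a subfield of the
  larger one by an embedding \<open>\<phi>\<close>.
\<close>

definition lifted_set :: "('k::field \<Rightarrow> 'a::field) \<Rightarrow> 'a set \<Rightarrow> ('k \<times> 'k) set \<Rightarrow> ('a \<times> 'a) set" where
  "lifted_set \<phi> I S = {(\<phi> x, \<phi> y + i) | x y i. i \<in> I \<and> (x, y) \<in> S}"

end

theory Submission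
  imports Defs
begin

text \<open>
  A nonzero coefficient vector \<open>u\<close> of the code defines the line \<open>u \<bullet> P = 0\<close>, and the corresponding
  codeword vanishes exactly at the points of \<open>X\<close> on that line.  Its weight is therefore
  \<open>|X| - |\<ell> \<inter> X|\<close>.  Every line comes from \<open>Q - 1\<close> vectors, which are the nonzero multiples of one of
  them.  As long as \<open>X\<close> is not contained in a line, distinct vectors give distinct codewords, so the
  weight enumerator is \<open>1 + (Q - 1) \<Sum> x^(|X| - |\<ell> \<inter> X|)\<close> (\<open>weight_enumerator_eq\<close>).

  In all three cases the number of lines that avoid the distinguished point and meet \<open>X\<close> in exactly
  \<open>k\<close> points is, for every \<open>k\<close>, divisible by the modulus.  Such lines cancel in the congruence, and
  what remains is the contribution of the pencil of lines through the distinguished point, whose intersection sizes are known exactly (\<open>weight_enumerator_cong_pencil\<close>).  The three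
  divisibilities have different reasons.

  For a set of pointed type, each line that avoids \<open>P0\<close> meets \<open>l0\<close> in one of its \<open>Q\<close> other points,
  and these \<open>Q\<close> points carry equally many \<open>k\<close>-secants (\<open>regular_pointed_dvd_card_secants\<close>).

  For the curve, the maps \<open>(x, y) \<mapsto> (x + a, y + a^q x + e)\<close> with suitable \<open>e\<close> preserve the equation,
  and they carry the lines of each of the \<open>q\<^sup>2\<close> slopes to the lines of slope \<open>0\<close>.  Among the
  lines of slope \<open>0\<close>, the intersection size depends only on the trace of the intercept, and each
  trace value is attained \<open>q\<close> times.  This gives the factor \<open>q\<^sup>3\<close> (\<open>card_curve_lines\<close>).

  For the lifted set, put \<open>V = GF(q) \<oplus> I\<close>, which has \<open>q^(s+1)\<close> elements, and consider \<open>y = m x + b\<close>.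
  If \<open>m\<close> and \<open>b\<close> lie in \<open>V\<close>, then reduction modulo \<open>I\<close> turns the intersection into that of \<open>S\<close> with a
  line over \<open>GF(q)\<close>; each such line arises \<open>q^(2s)\<close> times and a further factor \<open>q\<close> comes from the
  regularity of \<open>S\<close>.  If \<open>m \<in> V\<close> and \<open>b \<notin> V\<close>, the line misses the lifted set.  If \<open>m \<notin> V\<close>, the line
  meets it in at most one point, and the lines of that slope which meet it are as many as its points.
  In the last two cases both the slopes and the intercepts are counted by multiples of \<open>q^(s+1)\<close>
  (\<open>dvd_card_lifted_lines\<close>).
\<close>

section \<open>Counting by fibres\<close>

lemma card_eq_mult_card_image:
  assumes "finite A" and "\<And>y. y \<in> f ` A \<Longrightarrow> card {x \<in> A. f x = y} = k"
  shows "card A = k * card (f ` A)"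
proof -
  have "card A = (\<Sum>y\<in>f ` A. card {x \<in> A. f x = y})"
    using sum.image_gen[OF assms(1), of "\<lambda>_. 1::nat" f] by simp
  also have "\<dots> = k * card (f ` A)"
    using assms(2) by simp
  finally show ?thesis .
qed

lemma card_pairs_eq_sum:
  fixes P :: "'a::finite \<Rightarrow> 'b::finite \<Rightarrow> bool"
  shows "card {(m, b). m \<in> M \<and> P m b} = (\<Sum>m\<in>M. card {b. P m b})"
proof -
  have "{(m, b). m \<in> M \<and> P m b} = (SIGMA m:M. {b. P m b})" by auto
  then show ?thesis by simp
qed

lemma card_shift: "card {x :: 'a::ab_group_add. P (x + c)} = card {x. P x}"
proof -
  have "{x. P (x + c)} = (\<lambda>x. x - c) ` {x. P x}"
    by (force simp: image_iff intro: exI[of _ "_ + c"])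
  then show ?thesis by (simp add: card_image inj_on_def)
qed

lemma card_complement:
  fixes A :: "'a::finite set"
  shows "card (- A) = CARD('a) - card A"
  by (simp add: Compl_eq_Diff_UNIV card_Diff_subset)

lemma card_split:
  fixes P R :: "'a::finite \<Rightarrow> bool"
  shows "card {p. P p} = card {p. P p \<and> R p} + card {p. P p \<and> \<not> R p}"
proof -
  have "{p. P p} = {p. P p \<and> R p} \<union> {p. P p \<and> \<not> R p}" by auto
  then show ?thesis by (simp add: card_Un_disjoint disjoint_iff)
qed

section \<open>Congruences between counting polynomials\<close>

lemma sum_monom_const: "(\<Sum>x\<in>A. monom (1::int) i) = monom (int (card A)) i"
  by (simp add: of_nat_poly smult_monom)

lemma sum_monom_fibre:
  "(\<Sum>x | x \<in> A \<and> g x = k. monom (1::int) (f (g x))) = monom (int (card {x \<in> A. g x = k})) (f k)"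
  unfolding sum_monom_const[symmetric] by (rule sum.cong) auto

lemma coeff_sum_monom:
  assumes "finite A"
  shows "coeff (\<Sum>x\<in>A. monom (1::int) (g x)) i = int (card {x \<in> A. g x = i})"
proof -
  have "coeff (\<Sum>x\<in>A. monom (1::int) (g x)) i = (\<Sum>x\<in>A. if g x = i then 1 else 0)"
    by (simp add: coeff_sum)
  also have "\<dots> = int (card {x \<in> A. g x = i})"
    using assms by (simp add: sum.If_cases Int_def)
  finally show ?thesis .
qed

lemma poly_cong_iff_dvd: "poly_cong n p r \<longleftrightarrow> [:n:] dvd p - r"
  by (simp add: poly_cong_def const_poly_dvd_iff cong_iff_dvd_diff)

lemma poly_cong_trans: "poly_cong n p r \<Longrightarrow> poly_cong n r s \<Longrightarrow> poly_cong n p s"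
  unfolding poly_cong_def by (blast intro: cong_trans)

text \<open>
  The sum groups into \<open>\<Sum>k. N k x^(f k)\<close>, where \<open>N k\<close> counts the elements on which \<open>g\<close> takes the
  value \<open>k\<close>.  It is applied to a class of lines with \<open>g\<close> the intersection size.
\<close>

lemma dvd_sum_monom:
  assumes "finite A" and "\<And>k. n dvd card {x \<in> A. g x = k}"
  shows "[:int n:] dvd (\<Sum>x\<in>A. monom 1 (f (g x)))"
proof -
  have "(\<Sum>x\<in>A. monom (1::int) (f (g x))) = (\<Sum>k\<in>g ` A. \<Sum>x | x \<in> A \<and> g x = k. monom 1 (f (g x)))"
    by (rule sum.image_gen[OF assms(1)])
  also have "\<dots> = (\<Sum>k\<in>g ` A. monom (int (card {x \<in> A. g x = k})) (f k))"
    by (rule sum.cong[OF refl sum_monom_fibre])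
  also have "[:int n:] dvd \<dots>"
    using assms(2) by (intro dvd_sum) (simp add: const_poly_dvd_iff)
  finally show ?thesis .
qed

section \<open>Cardinality of subspaces over a finite field\<close>

text \<open>
  Adjoining an independent vector \<open>b\<close> multiplies the span by the scalars, since every element of the
  larger span is \<open>c b + x\<close> for exactly one pair \<open>(c, x)\<close>.
\<close>

lemma (in vector_space) card_span_independent:
  assumes "finite B" "independent B"
  shows "card (span B) = CARD('a) ^ card B"
  using assms
proof (induction B rule: finite_induct)
  case empty
  then show ?case by simp
next
  case (insert b B)
  have ind: "independent B" and b: "b \<notin> span B"
    using insert.prems insert.hyps by (auto simp: independent_insert)
  let ?f = "\<lambda>(c, x). scale c b + x"
  have "bij_betw ?f (UNIV \<times> span B) (span (insert b B))"
  proof (rule bij_betw_imageI)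
    show "inj_on ?f (UNIV \<times> span B)"
    proof (rule inj_onI, clarsimp)
      fix c x d y
      assume x: "x \<in> span B" and y: "y \<in> span B" and eq: "scale c b + x = scale d b + y"
      have diff: "scale (c - d) b = y - x"
        using eq by (simp add: algebra_simps)
      have "c = d"
      proof (rule ccontr)
        assume "c \<noteq> d"
        then have "b = scale (inverse (c - d)) (y - x)"
          by (simp flip: diff)
        with b show False by (metis span_scale span_diff x y)
      qed
      then show "c = d \<and> x = y" using eq by simp
    qed
    show "?f ` (UNIV \<times> span B) = span (insert b B)"
    proof (intro equalityI subsetI)
      fix v assume "v \<in> span (insert b B)"
      then obtain c where "v - scale c b \<in> span B" unfolding span_breakdown_eq by blast
      then show "v \<in> ?f ` (UNIV \<times> span B)"
        by (intro image_eqI[where x = "(c, v - scale c b)"]) simp_all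
    next
      fix v assume "v \<in> ?f ` (UNIV \<times> span B)"
      then obtain c x where "x \<in> span B" "v = scale c b + x" by force
      then show "v \<in> span (insert b B)"
        unfolding span_breakdown_eq by (intro exI[of _ c]) simp
    qed
  qed
  then have "card (span (insert b B)) = card ((UNIV :: 'a set) \<times> span B)"
    by (rule bij_betw_same_card[symmetric])
  also have "\<dots> = CARD('a) ^ card (insert b B)"
    using insert ind by (simp add: card_cartesian_product)
  finally show ?case .
qed

lemma (in vector_space) card_subspace:
  assumes "subspace S" "finite S"
  shows "card S = CARD('a) ^ dim S"
proof -
  obtain B where B: "B \<subseteq> S" "independent B" "S \<subseteq> span B" "card B = dim S"
    using basis_exists by blast
  moreover have "span B = S"
    using B assms(1) by (meson span_subspace)
  moreover have "finite B" using B(1) assms(2) finite_subset by blast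
  ultimately show ?thesis using card_span_independent by metis
qed

section \<open>Lines of the plane as kernels of linear forms\<close>

definition dotp :: "'a::comm_semiring_0 ^ 'n \<Rightarrow> 'a ^ 'n \<Rightarrow> 'a" where
  "dotp u v = (\<Sum>i\<in>UNIV. u $ i * v $ i)"

definition line_of :: "'a::field ^ 3 \<Rightarrow> ('a ^ 3) set set" where
  "line_of u = {P \<in> pg_points. \<forall>v\<in>P. dotp u v = 0}"

lemma dotp_commute: "dotp u v = dotp v u"
  by (simp add: dotp_def mult.commute)

lemma dotp_zero [simp]: "dotp u 0 = 0"
  by (simp add: dotp_def)

lemma dotp_add [simp]: "dotp u (v + w) = dotp u v + dotp u w"
  by (simp add: dotp_def distrib_left sum.distrib)

lemma dotp_diff [simp]: "dotp u (v - w) = dotp u v - dotp u (w :: 'a::field ^ 'n)"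
  by (simp add: dotp_def right_diff_distrib sum_subtractf)

lemma dotp_scale [simp]: "dotp u (c *s v) = c * dotp u (v :: 'a::field ^ 'n)"
  by (simp add: dotp_def sum_distrib_left mult.left_commute)

lemma dotp_linear_left [simp]:
  fixes u v w :: "'a::field ^ 'n"
  shows "dotp 0 v = 0" "dotp (u + w) v = dotp u v + dotp w v"
    "dotp (u - w) v = dotp u v - dotp w v" "dotp (c *s u) v = c * dotp u v"
  by (simp_all add: dotp_commute[of _ v])

lemma dotp_axis [simp]: "dotp u (axis i c) = u $ i * c"
proof -
  have "dotp u (axis i c) = (\<Sum>j\<in>UNIV. if j = i then u $ i * c else 0)"
    unfolding dotp_def by (rule sum.cong) (auto simp: axis_def)
  then show ?thesis by simp
qed

lemma subspace_kernel: "vec.subspace {v. dotp u (v :: 'a::field ^ 'n) = 0}"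
  by (rule vec.subspaceI) auto

lemma dim_UNIV_3: "vec.dim (UNIV :: ('a::field ^ 3) set) = 3"
  by (simp add: vec.dim_UNIV vec.dimension_def card_cart_basis)

text \<open>
  A vector outside the kernel spans a complement to it: subtracting the right multiple of a
  coordinate vector on which the form does not vanish moves any vector into the kernel.
\<close>

lemma dim_kernel:
  fixes u :: "'a::field ^ 3"
  assumes "u \<noteq> 0"
  shows "vec.dim {v. dotp u v = 0} = 2"
proof -
  obtain i where i: "u $ i \<noteq> 0" using assms by (auto simp: vec_eq_iff)
  let ?K = "{v. dotp u v = 0}" and ?E = "vec.span {axis i (1::'a)}"
  have sum: "{x + y |x y. x \<in> ?K \<and> y \<in> ?E} = UNIV"
  proof (intro equalityI subsetI UNIV_I)
    fix v :: "'a ^ 3"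
    let ?y = "(dotp u v / u $ i) *s axis i (1::'a)"
    have "v - ?y \<in> ?K" using i by simp
    moreover have "?y \<in> ?E" by (intro vec.span_scale vec.span_base) simp
    ultimately show "v \<in> {x + y |x y. x \<in> ?K \<and> y \<in> ?E}"
      by (intro CollectI exI[of _ "v - ?y"] exI[of _ ?y]) simp
  qed
  have int: "?K \<inter> ?E = {0}"
    using i by (auto simp: vec.span_singleton)
  have "vec.dim ?E = 1" by (simp add: axis_eq_0_iff)
  with vec.dim_sums_Int[OF subspace_kernel[of u] vec.subspace_span[of "{axis i (1::'a)}"]]
  show ?thesis using dim_UNIV_3[where 'a = 'a] unfolding sum int by simp
qed

lemma span_in_pg_points: "v \<noteq> 0 \<Longrightarrow> vec.span {v} \<in> pg_points"
  by (simp add: pg_points_def)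

lemma pg_pointsE:
  assumes "P \<in> pg_points"
  obtains v where "v \<noteq> 0" "P = vec.span {v}"
proof -
  have P: "vec.subspace P" "vec.dim P = 1" using assms by (auto simp: pg_points_def)
  then obtain v where v: "v \<in> P" "v \<noteq> 0"
    by (metis One_nat_def empty_iff equalityI subsetI insertI1 vec.dim_eq_0 zero_neq_one singletonI)
  have "vec.span {v} = P"
    using v P by (intro vec.subspace_dim_equal) (auto intro: vec.span_minimal[THEN subsetD])
  then show thesis using v that by blast
qed

lemma span_singleton_subset_iff: "vec.subspace W \<Longrightarrow> vec.span {v} \<subseteq> W \<longleftrightarrow> v \<in> W"
  using vec.span_minimal[of "{v}" W] vec.span_base[of v "{v}"] by auto

lemma line_of_conv_subspace: "line_of u = {P \<in> pg_points. P \<subseteq> {v. dotp u v = 0}}"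
  by (auto simp: line_of_def)

lemma span_in_line_of_iff: "v \<noteq> 0 \<Longrightarrow> vec.span {v} \<in> line_of u \<longleftrightarrow> dotp u v = 0"
  using span_singleton_subset_iff[OF subspace_kernel[of u], of v]
  by (auto simp: line_of_conv_subspace span_in_pg_points)

lemma card_field_ge_2: "CARD('a::{field,finite}) \<ge> 2"
  using card_mono[of UNIV "{0, 1::'a}"] by simp

text \<open>
  Over a finite field a form that vanishes on a plane can be found by the pigeonhole principle: there
  are \<open>Q\<^sup>3\<close> forms but only \<open>Q\<^sup>2\<close> possible pairs of values on a basis \<open>{a, b}\<close>, so two forms agree on
  the basis, and their difference vanishes on the plane.
\<close>

lemma exists_annihilator:
  fixes W :: "('a::{field,finite} ^ 3) set"
  assumes "vec.subspace W" "vec.dim W = 2"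
  obtains u where "u \<noteq> 0" "W = {v. dotp u v = 0}"
proof -
  obtain B where B: "B \<subseteq> W" "vec.independent B" "W \<subseteq> vec.span B" "card B = 2"
    using vec.basis_exists[of W] assms(2) by metis
  obtain a b where ab: "B = {a, b}" using B(4) by (auto simp: card_2_iff)
  have "card (UNIV :: ('a \<times> 'a) set) < card (UNIV :: ('a ^ 3) set)"
    using card_field_ge_2[where 'a = 'a]
    by (simp add: card_cartesian_product CARD_vec power3_eq_cube flip: UNIV_Times_UNIV)
  then have "\<not> inj (\<lambda>u. (dotp u a, dotp u b))"
    using card_inj_on_le[of "\<lambda>u. (dotp u a, dotp u b)" UNIV UNIV] by auto
  then obtain u w where uw: "u \<noteq> w" "dotp u a = dotp w a" "dotp u b = dotp w b"
    by (auto simp: inj_def)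
  have "W \<subseteq> {v. dotp (u - w) v = 0}"
    using B(3) vec.span_minimal[OF _ subspace_kernel, of B "u - w"] uw ab by auto
  then have "W = {v. dotp (u - w) v = 0}"
    using assms dim_kernel[of "u - w"] uw(1)
    by (intro vec.subspace_dim_equal subspace_kernel) (simp_all del: dotp_linear_left)
  with uw(1) show thesis by (intro that[of "u - w"]) auto
qed

lemma pg_lines_eq: "pg_lines = line_of ` {u :: 'a::{field,finite} ^ 3. u \<noteq> 0}"
proof (intro equalityI subsetI)
  fix l :: "('a ^ 3) set set" assume "l \<in> pg_lines"
  then obtain W where "l = {P \<in> pg_points. P \<subseteq> W}" "vec.subspace W" "vec.dim W = 2"
    by (auto simp: pg_lines_def)
  moreover from this obtain u where "u \<noteq> 0" "W = {v. dotp u v = 0}"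
    by (metis exists_annihilator)
  ultimately show "l \<in> line_of ` {u. u \<noteq> 0}"
    by (auto simp: line_of_conv_subspace)
next
  fix l :: "('a ^ 3) set set" assume "l \<in> line_of ` {u. u \<noteq> 0}"
  then obtain u where "l = line_of u" "u \<noteq> 0" by blast
  then show "l \<in> pg_lines"
    unfolding pg_lines_def line_of_conv_subspace using subspace_kernel dim_kernel by blast
qed

lemma span_singleton_eq_iff:
  fixes u w :: "'a::field ^ 3"
  assumes "u \<noteq> 0"
  shows "w \<noteq> 0 \<and> vec.span {w} = vec.span {u} \<longleftrightarrow> w \<in> vec.span {u} - {0}"
proof -
  have "vec.span {w} = vec.span {u}" if "w \<in> vec.span {u}" "w \<noteq> 0"
    using that assms
    by (intro vec.subspace_dim_equal vec.subspace_span)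
      (auto simp: span_singleton_subset_iff[OF vec.subspace_span])
  then show ?thesis using vec.span_base[of w "{w}"] by auto
qed

text \<open>
  The kernel determines the form up to a scalar because it contains the vectors
  \<open>u\<^sub>i e\<^sub>j - u\<^sub>j e\<^sub>i\<close>: a form \<open>w\<close> that kills these satisfies \<open>w\<^sub>j u\<^sub>i = w\<^sub>i u\<^sub>j\<close> for all \<open>j\<close>.
\<close>

lemma line_of_eq_iff:
  fixes u w :: "'a::field ^ 3"
  assumes "u \<noteq> 0" "w \<noteq> 0"
  shows "line_of w = line_of u \<longleftrightarrow> w \<in> vec.span {u}"
proof
  assume eq: "line_of w = line_of u"
  have orth: "dotp w v = 0" if "dotp u v = 0" for v
  proof (cases "v = 0")
    case False
    then show ?thesis using that eq span_in_line_of_iff by metis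
  qed simp
  obtain i where i: "u $ i \<noteq> 0" using assms(1) by (auto simp: vec_eq_iff)
  have "w = (w $ i / u $ i) *s u"
  proof (subst vec_eq_iff, intro allI)
    fix j
    have "dotp w (axis j (u $ i) - axis i (u $ j)) = 0"
      by (rule orth) (simp add: mult.commute)
    then show "w $ j = ((w $ i / u $ i) *s u) $ j"
      using i by (simp add: field_simps)
  qed
  then show "w \<in> vec.span {u}" by (auto simp: vec.span_singleton)
next
  assume "w \<in> vec.span {u}"
  then obtain c where "w = c *s u" by (auto simp: vec.span_singleton)
  with assms show "line_of w = line_of u" by (auto simp: line_of_def)
qed

lemma card_point:
  fixes P :: "('a::{field,finite} ^ 3) set"
  assumes "P \<in> pg_points"
  shows "card (P - {0}) = CARD('a) - 1"
proof -
  have P: "vec.subspace P" "vec.dim P = 1" using assms by (auto simp: pg_points_def)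
  then have "card P = CARD('a)" using vec.card_subspace[of P] by simp
  then show ?thesis using vec.subspace_0[OF P(1)] by (simp add: card_Diff_singleton)
qed

lemma card_line_of_fibre:
  fixes u :: "'a::{field,finite} ^ 3"
  assumes "u \<noteq> 0"
  shows "card {w. w \<noteq> 0 \<and> line_of w = line_of u} = CARD('a) - 1"
proof -
  have "{w. w \<noteq> 0 \<and> line_of w = line_of u} = vec.span {u} - {0}"
    using line_of_eq_iff[OF assms] by auto
  then show ?thesis using card_point[OF span_in_pg_points[OF assms]] by simp
qed

lemma card_kernel:
  fixes u :: "'a::{field,finite} ^ 3"
  assumes "u \<noteq> 0"
  shows "card {v. v \<noteq> 0 \<and> dotp u v = 0} = (CARD('a) - 1) * (CARD('a) + 1)"
proof -
  have "{v. v \<noteq> 0 \<and> dotp u v = 0} = {v. dotp u v = 0} - {0}" by auto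
  then have "card {v. v \<noteq> 0 \<and> dotp u v = 0} = CARD('a) ^ 2 - 1"
    using vec.card_subspace[OF subspace_kernel[of u]] dim_kernel[OF assms]
    by (simp add: card_Diff_singleton)
  then show ?thesis by (simp add: algebra_simps power2_eq_square)
qed

text \<open>
  The \<open>Q\<^sup>2 - 1\<close> nonzero vectors of a plane are shared out among its points, \<open>Q - 1\<close> to each.
\<close>

lemma card_pg_line:
  fixes l :: "('a::{field,finite} ^ 3) set set"
  assumes "l \<in> pg_lines"
  shows "card l = CARD('a) + 1"
proof -
  obtain u where u: "u \<noteq> 0" "l = line_of u" using assms by (auto simp: pg_lines_eq)
  let ?K = "{v. v \<noteq> 0 \<and> dotp u v = 0}"
  have l: "l = (\<lambda>v. vec.span {v}) ` ?K"
    unfolding u(2) using span_in_line_of_iff[of _ u]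
    by (auto elim!: pg_pointsE simp: line_of_def span_in_pg_points)
  have "card ?K = (CARD('a) - 1) * card ((\<lambda>v. vec.span {v}) ` ?K)"
  proof (rule card_eq_mult_card_image)
    fix P assume "P \<in> (\<lambda>v. vec.span {v}) ` ?K"
    then obtain v where v: "v \<noteq> 0" "dotp u v = 0" "P = vec.span {v}" by auto
    have "w \<in> ?K" if "w \<in> P - {0}" for w
      using that v by (auto simp: vec.span_singleton)
    then have "{w \<in> ?K. vec.span {w} = P} = P - {0}"
      using span_singleton_eq_iff[OF v(1)] v(3) by blast
    then show "card {w \<in> ?K. vec.span {w} = P} = CARD('a) - 1"
      using card_point[OF span_in_pg_points[OF v(1)]] v(3) by simp
  qed simp
  then have "(CARD('a) - 1) * card l = (CARD('a) - 1) * (CARD('a) + 1)"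
    using card_kernel[OF u(1)] l by metis
  then show ?thesis
    using card_field_ge_2[where 'a = 'a] by (subst (asm) mult_cancel1) simp
qed

text \<open>
  The dual of \<open>card_pg_line\<close>: the forms that vanish at a point are shared out among the lines through
  it.
\<close>

lemma card_lines_through_point:
  fixes P :: "('a::{field,finite} ^ 3) set"
  assumes "P \<in> pg_points"
  shows "card {l \<in> pg_lines. P \<in> l} = CARD('a) + 1"
proof -
  obtain v where v: "v \<noteq> 0" "P = vec.span {v}" using assms by (rule pg_pointsE)
  let ?K = "{u. u \<noteq> 0 \<and> dotp v u = 0}"
  have l: "{l \<in> pg_lines. P \<in> l} = line_of ` ?K"
    by (auto simp: pg_lines_eq v span_in_line_of_iff dotp_commute[of v])
  have "card ?K = (CARD('a) - 1) * card (line_of ` ?K)"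
  proof (rule card_eq_mult_card_image)
    fix m assume "m \<in> line_of ` ?K"
    then obtain u where u: "u \<noteq> 0" "dotp v u = 0" "m = line_of u" by auto
    have "{w \<in> ?K. line_of w = m} = {w. w \<noteq> 0 \<and> line_of w = line_of u}"
      using u v by (auto simp: dotp_commute[of v] simp flip: span_in_line_of_iff)
    then show "card {w \<in> ?K. line_of w = m} = CARD('a) - 1"
      using card_line_of_fibre[OF u(1)] by simp
  qed simp
  then have "(CARD('a) - 1) * card {l \<in> pg_lines. P \<in> l} = (CARD('a) - 1) * (CARD('a) + 1)"
    using card_kernel[OF v(1)] l by metis
  then show ?thesis
    using card_field_ge_2[where 'a = 'a] by (subst (asm) mult_cancel1) simp
qed

lemma pg_lines_meet:
  fixes l l' :: "('a::field ^ 3) set set"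
  assumes "l \<in> pg_lines" "l' \<in> pg_lines" "l \<noteq> l'"
  shows "\<exists>P. l \<inter> l' = {P}"
proof -
  obtain W W' where W: "l = {P \<in> pg_points. P \<subseteq> W}" "vec.subspace W" "vec.dim W = 2"
    and W': "l' = {P \<in> pg_points. P \<subseteq> W'}" "vec.subspace W'" "vec.dim W' = 2"
    using assms(1,2) by (auto simp: pg_lines_def)
  let ?S = "{x + y |x y. x \<in> W \<and> y \<in> W'}"
  have "vec.dim (W \<inter> W') \<noteq> 2"
  proof
    assume "vec.dim (W \<inter> W') = 2"
    then have "W \<inter> W' = W" "W \<inter> W' = W'"
      using W W' by (intro vec.subspace_dim_equal vec.subspace_inter; simp)+
    with assms(3) W W' show False by simp
  qed
  moreover have "vec.dim (W \<inter> W') \<le> 2" using W(3) vec.dim_subset[of "W \<inter> W'" W] by simp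
  moreover have "vec.dim ?S \<le> 3" using vec.dim_subset[of ?S UNIV] unfolding dim_UNIV_3 by simp
  moreover have "vec.dim ?S + vec.dim (W \<inter> W') = 4"
    using vec.dim_sums_Int[of W W'] W W' by simp
  ultimately have dim: "vec.dim (W \<inter> W') = 1" by linarith
  then have "W \<inter> W' \<in> pg_points" using W W' by (simp add: pg_points_def vec.subspace_inter)
  moreover have "P = W \<inter> W'" if "P \<in> pg_points" "P \<subseteq> W \<inter> W'" for P
    using that dim vec.subspace_dim_equal[of P "W \<inter> W'"] vec.subspace_inter[OF W(2) W'(2)]
    by (simp add: pg_points_def)
  ultimately have "l \<inter> l' = {W \<inter> W'}" unfolding W(1) W'(1) by blast
  then show ?thesis by blast
qed

section \<open>Weights of the projective code\<close>

lemma code_generated_by_eq: "code_generated_by cols = range (\<lambda>u. map (dotp u) cols)"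
  by (auto simp: code_generated_by_def dotp_def[abs_def])

text \<open>
  A column is orthogonal to \<open>u\<close> exactly if the point it represents is on \<open>line_of u\<close>.  For \<open>u = 0\<close>, the
  set \<open>line_of u\<close> is the whole plane, so that the formula also gives the weight of the zero word.
\<close>

lemma hamming_weight_eq:
  fixes cols :: "('a::{field,finite} ^ 3) list"
  assumes "distinct (map (\<lambda>c. vec.span {c}) cols)" "set (map (\<lambda>c. vec.span {c}) cols) = X"
    and "X \<subseteq> pg_points"
  shows "hamming_weight (map (dotp u) cols) = card X - card (line_of u \<inter> X)"
proof -
  define sp where "sp = (\<lambda>i. vec.span {cols ! i})"
  let ?Z = "{i. i < length cols \<and> dotp u (cols ! i) = 0}"
  have n: "card X = length cols"
    using distinct_card[OF assms(1)] assms(2) by simp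
  have X: "X = sp ` {..<length cols}"
    unfolding assms(2)[symmetric] sp_def by (auto simp: in_set_conv_nth intro!: imageI)
  have inj: "inj_on sp {..<length cols}"
    using assms(1) by (auto simp: sp_def inj_on_def distinct_conv_nth)
  have nz: "cols ! i \<noteq> 0" if "i < length cols" for i
  proof
    assume "cols ! i = 0"
    then have "sp i = {0}" by (simp add: sp_def)
    moreover have "sp i \<in> pg_points" using that X assms(3) by auto
    ultimately show False by (simp add: pg_points_def)
  qed
  have "line_of u \<inter> X = sp ` ?Z"
    using nz by (auto simp: X sp_def span_in_line_of_iff)
  then have "card (line_of u \<inter> X) = card ?Z"
    using card_image[OF inj_on_subset[OF inj], of ?Z] by auto
  moreover have "{i. i < length cols \<and> map (dotp u) cols ! i \<noteq> 0} = {..<length cols} - ?Z"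
    by auto
  moreover have "card ({..<length cols} - ?Z) = length cols - card ?Z"
    by (subst card_Diff_subset) auto
  ultimately show ?thesis by (simp add: hamming_weight_def n)
qed

text \<open>
  Since \<open>X\<close> lies on no line, the difference of two distinct coefficient vectors cannot vanish on all of
  \<open>X\<close>, so distinct vectors give distinct codewords.  Positive weight excludes the zero vector, so
  that every vector counted determines a line.
\<close>

lemma card_codewords_of_weight:
  fixes X :: "('a::{field,finite} ^ 3) set set"
  assumes X: "X \<subseteq> pg_points" and noncol: "\<forall>l\<in>pg_lines. \<not> X \<subseteq> l"
    and C: "is_projective_code X C" and i: "i > 0"
  shows "card {c \<in> C. hamming_weight c = i} =
    (CARD('a) - 1) * card {l \<in> pg_lines. card X - card (l \<inter> X) = i}"
proof -
  obtain cols where cols: "distinct (map (\<lambda>c. vec.span {c}) cols)"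
      "set (map (\<lambda>c. vec.span {c}) cols) = X" "C = code_generated_by cols"
    using C by (auto simp: is_projective_code_def)
  let ?w = "\<lambda>u. map (dotp u) cols"
  let ?U = "{u. u \<noteq> 0 \<and> card X - card (line_of u \<inter> X) = i}"
  note wt = hamming_weight_eq[OF cols(1,2) X]
  have "inj ?w"
  proof (rule injI, rule ccontr)
    fix u v assume eq: "?w u = ?w v" and "u \<noteq> v"
    then have "line_of (u - v) \<in> pg_lines" by (auto simp: pg_lines_eq)
    then have "\<not> X \<subseteq> line_of (u - v)" using noncol by (rule_tac bspec)
    then have "line_of (u - v) \<inter> X \<subset> X" by auto
    then have "card (line_of (u - v) \<inter> X) < card X"
      by (rule psubset_card_mono[OF finite])
    moreover have "hamming_weight (?w (u - v)) = 0"
      using eq by (auto simp: hamming_weight_def map_eq_conv)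
    ultimately show False by (simp add: wt)
  qed
  have "{c \<in> C. hamming_weight c = i} = ?w ` {u. hamming_weight (?w u) = i}"
    by (auto simp: cols(3) code_generated_by_eq)
  also have "{u. hamming_weight (?w u) = i} = ?U"
  proof -
    have "line_of 0 \<inter> X = X" using X by (auto simp: line_of_def)
    then show ?thesis using i by (auto simp: wt)
  qed
  finally have "card {c \<in> C. hamming_weight c = i} = card ?U"
    using card_image[OF inj_on_subset[OF \<open>inj ?w\<close> subset_UNIV], of ?U] by simp
  also have "\<dots> = (CARD('a) - 1) * card (line_of ` ?U)"
  proof (rule card_eq_mult_card_image)
    fix l assume "l \<in> line_of ` ?U"
    then obtain u where u: "u \<noteq> 0" "card X - card (line_of u \<inter> X) = i" "l = line_of u" by blast
    then have "{w \<in> ?U. line_of w = l} = {w. w \<noteq> 0 \<and> line_of w = line_of u}" by auto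
    then show "card {w \<in> ?U. line_of w = l} = CARD('a) - 1"
      using card_line_of_fibre[OF u(1)] by simp
  qed simp
  also have "line_of ` ?U = {l \<in> pg_lines. card X - card (l \<inter> X) = i}"
    by (auto simp: pg_lines_eq)
  finally show ?thesis .
qed

lemma weight_enumerator_eq:
  fixes X :: "('a::{field,finite} ^ 3) set set"
  assumes X: "X \<subseteq> pg_points" and noncol: "\<forall>l\<in>pg_lines. \<not> X \<subseteq> l"
    and C: "is_projective_code X C"
  shows "weight_enumerator (card X) C =
    1 + smult (int CARD('a) - 1) (\<Sum>l\<in>pg_lines. monom 1 (card X - card (l \<inter> X)))"
proof -
  let ?N = "\<lambda>i. card {l \<in> pg_lines. card X - card (l \<inter> X) = i}"
  have "coeff (\<Sum>i = 1..card X. monom (int (card {c \<in> C. hamming_weight c = i})) i) j =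
      coeff (smult (int CARD('a) - 1) (\<Sum>l\<in>pg_lines. monom 1 (card X - card (l \<inter> X)))) j" for j
  proof -
    have "?N 0 = 0"
    proof -
      have "card X - card (l \<inter> X) \<noteq> 0" if "l \<in> pg_lines" for l
      proof -
        have "l \<inter> X \<subset> X" using noncol that by auto
        then show ?thesis using psubset_card_mono[of X "l \<inter> X"] by simp
      qed
      then show ?thesis by auto
    qed
    moreover have "?N j = 0" if "j > card X" using that by auto
    moreover have "int (card {c \<in> C. hamming_weight c = j}) = (int CARD('a) - 1) * int (?N j)"
      if "j > 0" for j
      using card_codewords_of_weight[OF X noncol C that] card_field_ge_2[where 'a = 'a]
      by (simp add: of_nat_diff)
    moreover have "coeff (\<Sum>i = 1..card X. monom (int (card {c \<in> C. hamming_weight c = i})) i) j =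
        (if j \<in> {1..card X} then int (card {c \<in> C. hamming_weight c = j}) else 0)"
      by (simp add: coeff_sum)
    ultimately show ?thesis by (cases "j = 0"; cases "j > card X") (auto simp: coeff_sum_monom)
  qed
  then show ?thesis by (simp add: weight_enumerator_def poly_eq_iff)
qed

lemma sum_intersection_enumerator:
  "(\<Sum>i\<le>card X. monom (coeff (intersection_enumerator X) i) (card X - i)) =
    (\<Sum>l\<in>pg_lines. monom 1 (card X - card (l \<inter> X)))"
  for X :: "('a::{field,finite} ^ 3) set set"
proof -
  have "(\<Sum>l\<in>pg_lines. monom (1::int) (card X - card (l \<inter> X))) =
      (\<Sum>i\<le>card X. \<Sum>l | l \<in> pg_lines \<and> card (l \<inter> X) = i. monom 1 (card X - card (l \<inter> X)))"
    by (rule sum.group[symmetric]) (auto intro: card_mono)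
  also have "\<dots> = (\<Sum>i\<le>card X. monom (coeff (intersection_enumerator X) i) (card X - i))"
    unfolding intersection_enumerator_def coeff_sum_monom[OF finite]
    by (rule sum.cong[OF refl sum_monom_fibre])
  finally show ?thesis by simp
qed

text \<open>
  This is the common frame of the three congruences: modulo \<open>n\<close> only the pencil through \<open>P0\<close>
  survives as soon as the lines that avoid \<open>P0\<close> are, for each intersection size, a multiple of \<open>n\<close> in
  number.
\<close>

lemma weight_enumerator_cong_pencil:
  fixes X :: "('a::{field,finite} ^ 3) set set"
  assumes X: "X \<subseteq> pg_points" and noncol: "\<forall>l\<in>pg_lines. \<not> X \<subseteq> l"
    and C: "is_projective_code X C"
    and dvd: "\<And>k. n dvd card {l \<in> pg_lines. P0 \<notin> l \<and> card (l \<inter> X) = k}"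
  shows "poly_cong (int n) (weight_enumerator (card X) C)
    (1 + smult (int CARD('a) - 1)
      (\<Sum>l | l \<in> pg_lines \<and> P0 \<in> l. monom 1 (card X - card (l \<inter> X))))"
proof -
  let ?m = "\<lambda>l. monom (1::int) (card X - card (l \<inter> X))"
  have "pg_lines = {l \<in> pg_lines. P0 \<in> l} \<union> {l \<in> pg_lines. P0 \<notin> l}" by auto
  then have "sum ?m pg_lines = sum ?m {l \<in> pg_lines. P0 \<in> l} + sum ?m {l \<in> pg_lines. P0 \<notin> l}"
    by (metis (no_types, lifting) sum.union_disjoint finite disjoint_iff mem_Collect_eq)
  moreover have "[:int n:] dvd sum ?m {l \<in> pg_lines. P0 \<notin> l}"
    using dvd by (intro dvd_sum_monom[where f = "\<lambda>k. card X - k" and g = "\<lambda>l. card (l \<inter> X)"]) auto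
  ultimately show ?thesis
    unfolding poly_cong_iff_dvd weight_enumerator_eq[OF X noncol C]
    by (simp add: smult_add_right dvd_smult)
qed

section \<open>Sets of pointed type\<close>

text \<open>
  There are at least three lines through \<open>P0\<close>.  If \<open>X\<close> were contained in a line \<open>l\<close>, one of the lines
  different from \<open>l0\<close> and \<open>l\<close> would meet \<open>X\<close> in \<open>P0\<close> only, but it is a \<open>(t + 1)\<close>-secant.
\<close>

lemma regular_pointed_not_in_line:
  fixes X :: "('a::{field,finite} ^ 3) set set"
  assumes reg: "regular_pointed_at P0 l0 t ms X"
  shows "\<forall>l\<in>pg_lines. \<not> X \<subseteq> l"
proof (intro ballI notI)
  fix l assume l: "l \<in> pg_lines" and Xl: "X \<subseteq> l"
  have P0: "P0 \<in> X" "P0 \<in> pg_points" and t: "t > 0"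
    using reg by (auto simp: regular_pointed_at_def)
  have "card {l0, l} \<le> 2" by (simp add: card_insert_if)
  then have "\<not> {l \<in> pg_lines. P0 \<in> l} \<subseteq> {l0, l}"
    using card_mono[of "{l0, l}" "{l \<in> pg_lines. P0 \<in> l}"] card_lines_through_point[OF P0(2)]
      card_field_ge_2[where 'a = 'a] by auto
  then obtain l' where l': "l' \<in> pg_lines" "P0 \<in> l'" "l' \<noteq> l0" "l' \<noteq> l" by auto
  then have "card (l' \<inter> X) = t + 1"
    using reg by (auto simp: regular_pointed_at_def is_secant_def)
  moreover obtain P where "l' \<inter> l = {P}" using pg_lines_meet l l' by metis
  then have "card (l' \<inter> X) \<le> 1"
    using card_mono[of "{P}" "l' \<inter> X"] Xl by auto
  ultimately show False using t by simp
qed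

text \<open>
  Sorting the lines that avoid \<open>P0\<close> by the point in which they meet \<open>l0\<close> gives \<open>Q\<close> classes of equal
  size.  The definition of pointed type counts all \<open>k\<close>-secants through a point of \<open>l0\<close>, and this
  includes \<open>l0\<close> itself when \<open>k = 1\<close>; the correction is the same for each point.
\<close>

lemma regular_pointed_dvd_card_secants:
  fixes X :: "('a::{field,finite} ^ 3) set set"
  assumes reg: "regular_pointed_at P0 l0 t ms X"
  shows "CARD('a) dvd card {l \<in> pg_lines. P0 \<notin> l \<and> card (l \<inter> X) = k}"
    (is "_ dvd card ?L")
proof (cases "k \<in> set ms")
  case False
  have "?L = {}"
    using reg False by (auto simp: regular_pointed_at_def is_secant_def)
  then show ?thesis by (simp only: card.empty dvd_0_right)
next
  case True
  have l0: "l0 \<in> pg_lines" "P0 \<in> l0" using reg by (auto simp: regular_pointed_at_def)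
  let ?A = "l0 - {P0}"
  let ?c = "\<lambda>P. card {l. is_secant k X l \<and> P \<in> l}"
  define foot where "foot l = the_elem (l \<inter> l0)" for l
  have foot: "l \<inter> l0 = {foot l}" "foot l \<noteq> P0" if "l \<in> ?L" for l
  proof -
    have "l \<in> pg_lines" "l \<noteq> l0" using that l0 by auto
    then obtain P where "l \<inter> l0 = {P}" using pg_lines_meet[OF _ l0(1)] by metis
    then show "l \<inter> l0 = {foot l}" by (simp add: foot_def)
    then show "foot l \<noteq> P0" using that by auto
  qed
  have cardA: "card ?A = CARD('a)"
    using card_pg_line[OF l0(1)] l0 by simp
  have "card ?L = (\<Sum>P\<in>?A. card {l \<in> ?L. foot l = P})"
  proof -
    have "foot ` ?L \<subseteq> ?A" using foot by blast
    then show ?thesis using sum.group[of ?L ?A foot "\<lambda>_. 1::nat"] by simp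
  qed
  also have "\<dots> = (\<Sum>P\<in>?A. ?c P - (if is_secant k X l0 then 1 else 0))"
  proof (rule sum.cong[OF refl])
    fix P assume P: "P \<in> ?A"
    have "{l \<in> ?L. foot l = P} = {l. is_secant k X l \<and> P \<in> l} - {l0}"
    proof (intro equalityI subsetI)
      fix l assume "l \<in> {l \<in> ?L. foot l = P}"
      then show "l \<in> {l. is_secant k X l \<and> P \<in> l} - {l0}"
        using foot[of l] l0 by (auto simp: is_secant_def)
    next
      fix l assume l: "l \<in> {l. is_secant k X l \<and> P \<in> l} - {l0}"
      then have "l \<in> pg_lines" "l \<noteq> l0" by (auto simp: is_secant_def)
      then obtain R where R: "l \<inter> l0 = {R}" using pg_lines_meet[OF _ l0(1)] by metis
      with l P l0 have "P0 \<notin> l" by blast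
      with l have "l \<in> ?L" by (auto simp: is_secant_def)
      with foot[of l] l P show "l \<in> {l \<in> ?L. foot l = P}" by auto
    qed
    then show "card {l \<in> ?L. foot l = P} = ?c P - (if is_secant k X l0 then 1 else 0)"
      using P by (simp add: card_Diff_singleton_if)
  qed
  also have "\<exists>c. \<dots> = CARD('a) * c"
  proof -
    have "?A \<noteq> {}"
    proof
      assume "?A = {}"
      then have "card ?A = 0" by (simp only: card.empty)
      then show False using cardA card_field_ge_2[where 'a = 'a] by linarith
    qed
    then obtain P where P: "P \<in> ?A" by blast
    have "?c R = ?c P" if "R \<in> ?A" for R
      using reg True P that unfolding regular_pointed_at_def by blast
    then show ?thesis
      using cardA by (intro exI[of _ "?c P - (if is_secant k X l0 then 1 else 0)"]) simp
  qed
  finally show ?thesis by auto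
qed

text \<open>
  Besides the tangent \<open>l0\<close> the pencil through \<open>P0\<close> has \<open>Q\<close> lines, all \<open>(t + 1)\<close>-secants, which cancel
  modulo \<open>Q\<close>.
\<close>

lemma regular_pointed_weight_enumerator_cong:
  fixes X :: "('a::{field,finite} ^ 3) set set"
  assumes reg: "regular_pointed_at P0 l0 t ms X" and C: "is_projective_code X C"
  shows "poly_cong (int CARD('a)) (weight_enumerator (card X) C) (1 - monom 1 (card X - 1))"
proof -
  let ?Q = "int CARD('a)"
  have X: "X \<subseteq> pg_points" and P0: "P0 \<in> pg_points" and l0: "l0 \<in> pg_lines" "P0 \<in> l0" "l0 \<inter> X = {P0}"
    using reg by (auto simp: regular_pointed_at_def)
  let ?L = "{l \<in> pg_lines. P0 \<in> l} - {l0}"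
  have "card ?L = CARD('a)"
    using card_lines_through_point[OF P0] l0 by simp
  moreover have "card (l \<inter> X) = t + 1" if "l \<in> ?L" for l
    using reg that by (auto simp: regular_pointed_at_def is_secant_def)
  ultimately have rest: "(\<Sum>l\<in>?L. monom 1 (card X - card (l \<inter> X))) = monom ?Q (card X - (t + 1))"
    by (simp del: sum_constant add: sum_monom_const)
  have pencil: "(\<Sum>l | l \<in> pg_lines \<and> P0 \<in> l. monom 1 (card X - card (l \<inter> X))) =
      monom 1 (card X - 1) + monom ?Q (card X - (t + 1))"
    using sum.remove[of "{l \<in> pg_lines. P0 \<in> l}" l0 "\<lambda>l. monom (1::int) (card X - card (l \<inter> X))"]
      l0 rest by simp
  have "poly_cong ?Q (weight_enumerator (card X) C)
    (1 + smult (?Q - 1) (monom 1 (card X - 1) + monom ?Q (card X - (t + 1))))"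
    using weight_enumerator_cong_pencil[OF X regular_pointed_not_in_line[OF reg] C
        regular_pointed_dvd_card_secants[OF reg]] unfolding pencil .
  moreover have "poly_cong ?Q (1 + smult (?Q - 1) (monom 1 (card X - 1) + monom ?Q (card X - (t + 1))))
      (1 - monom 1 (card X - 1))"
  proof -
    have "1 + smult (?Q - 1) (monom 1 (card X - 1) + monom ?Q (card X - (t + 1))) -
        (1 - monom 1 (card X - 1)) =
        [:?Q:] * (monom 1 (card X - 1) + monom (?Q - 1) (card X - (t + 1)))"
      by (simp add: smult_add_right smult_monom algebra_simps flip: add_monom diff_monom)
    then show ?thesis unfolding poly_cong_iff_dvd by (simp only: dvd_triv_left)
  qed
  ultimately show ?thesis by (rule poly_cong_trans)
qed

section \<open>Affine coordinates\<close>

lemma dotp_vector: "dotp (vector [a, b, c] :: 'a::comm_semiring_1 ^ 3) (vector [x, y, z]) = a * x + b * y + c * z"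
  by (simp add: dotp_def sum_3)

lemma vector_eq_0_iff: "vector [a, b, c] = (0 :: 'a::zero ^ 3) \<longleftrightarrow> a = 0 \<and> b = 0 \<and> c = 0"
  by (auto simp: vec_eq_iff forall_3)

lemma affine_point_in_line_of_iff:
  "affine_point (x, y) \<in> line_of (vector [a, b, c]) \<longleftrightarrow> a * x + b * y + c = 0"
  by (simp add: affine_point_def pg_point_def span_in_line_of_iff vector_eq_0_iff dotp_vector)

lemma point_infinity_in_line_of_iff: "point_infinity \<in> line_of (vector [a, b, c]) \<longleftrightarrow> b = 0"
  by (simp add: point_infinity_def pg_point_def span_in_line_of_iff vector_eq_0_iff dotp_vector)

lemma affine_point_in_pg_points: "affine_point p \<in> pg_points"
  by (cases p) (simp add: affine_point_def pg_point_def span_in_pg_points vector_eq_0_iff)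

lemma point_infinity_in_pg_points: "point_infinity \<in> pg_points"
  by (simp add: point_infinity_def pg_point_def span_in_pg_points vector_eq_0_iff)

definition vertical_line :: "'a::field \<Rightarrow> ('a ^ 3) set set" where
  "vertical_line a = line_of (vector [1, 0, - a])"

definition graph_line :: "'a::field \<Rightarrow> 'a \<Rightarrow> ('a ^ 3) set set" where
  "graph_line m b = line_of (vector [m, - 1, b])"

lemma line_infinity_eq: "line_infinity = line_of (vector [0, 0, 1])"
  by (simp add: line_infinity_def line_of_def dotp_def sum_3)

lemma incidence_simps [simp]:
  "affine_point (x, y) \<notin> line_infinity"
  "affine_point (x, y) \<in> vertical_line a \<longleftrightarrow> x = a"
  "affine_point (x, y) \<in> graph_line m b \<longleftrightarrow> y = m * x + b"
  "point_infinity \<in> line_infinity" "point_infinity \<in> vertical_line a"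
  "point_infinity \<notin> graph_line m b"
  by (auto simp: line_infinity_eq vertical_line_def graph_line_def affine_point_in_line_of_iff
      point_infinity_in_line_of_iff algebra_simps eq_neg_iff_add_eq_0)

lemma affine_point_neq_infinity [simp]: "affine_point p \<noteq> point_infinity"
  using incidence_simps(1)[of "fst p" "snd p"] incidence_simps(4) by force

lemma point_infinity_not_affine: "point_infinity \<notin> affine_point ` A"
  by (metis imageE affine_point_neq_infinity)

lemma inj_affine_point: "inj affine_point"
proof (rule injI, clarify)
  fix x y x' y' :: 'a assume eq: "affine_point (x, y) = affine_point (x', y')"
  have "x' = x"
    using incidence_simps(2)[of x y x] eq by simp
  moreover have "y' = y"
    using incidence_simps(3)[of x y 0 y] eq by simp
  ultimately show "x = x' \<and> y = y'" by simp
qed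

lemma line_of_scale: "c \<noteq> 0 \<Longrightarrow> line_of (c *s u) = line_of u"
  by (simp add: line_of_def)

lemma lines_in_pg_lines [simp]:
  fixes a m b :: "'a::{field,finite}"
  shows "(line_infinity :: ('a ^ 3) set set) \<in> pg_lines" "vertical_line a \<in> pg_lines"
    "graph_line m b \<in> pg_lines"
  by (auto simp: line_infinity_eq vertical_line_def graph_line_def pg_lines_eq vector_eq_0_iff)

lemma line_cases:
  fixes l :: "('a::{field,finite} ^ 3) set set"
  assumes "l \<in> pg_lines"
  obtains "l = line_infinity" | a where "l = vertical_line a" | m b where "l = graph_line m b"
proof -
  obtain u where u: "u \<noteq> 0" "l = line_of u" using assms by (auto simp: pg_lines_eq)
  define a b c where "a = u $ 1" "b = u $ 2" "c = u $ 3"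
  have vec: "u = vector [a, b, c]" by (simp add: vec_eq_iff forall_3 a_b_c_def)
  consider "a = 0" "b = 0" | "a \<noteq> 0" "b = 0" | "b \<noteq> 0" by blast
  then show thesis
  proof cases
    case 1
    then have "u = c *s vector [0, 0, 1]" "c \<noteq> 0"
      using vec u(1) by (auto simp: vec_eq_iff forall_3)
    then show thesis using u(2) that(1) by (simp add: line_infinity_eq line_of_scale)
  next
    case 2
    \<comment> \<open>The double negation makes the vector match the normal form with abscissa \<open>- c / a\<close>.\<close>
    then have "u = a *s vector [1, 0, - (- c / a)]"
      using vec by (auto simp: vec_eq_iff forall_3)
    then show thesis using 2 u(2) that(2)[of "- c / a"] by (simp add: vertical_line_def line_of_scale)
  next
    case 3
    then have "u = (- b) *s vector [- a / b, - 1, - c / b]"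
      using vec by (auto simp: vec_eq_iff forall_3)
    then have "l = graph_line (- a / b) (- c / b)"
      unfolding u(2) graph_line_def using 3 line_of_scale neg_equal_0_iff_equal by metis
    then show thesis by (rule that(3))
  qed
qed

lemma inj_vertical_line: "inj vertical_line"
  by (rule injI) (metis incidence_simps(2))

lemma inj_graph_line: "inj (\<lambda>(m, b). graph_line m b)"
proof (rule injI, clarify)
  fix m b m' b' :: 'a assume eq: "graph_line m b = graph_line m' b'"
  have *: "m * x + b = m' * x + b'" for x
    using incidence_simps(3)[of x "m * x + b" m b] eq by simp
  show "m = m' \<and> b = b'" using *[of 0] *[of 1] by simp
qed

lemma lines_through_infinity:
  "{l \<in> pg_lines. point_infinity \<in> l} =
    insert line_infinity (range (vertical_line :: 'a::{field,finite} \<Rightarrow> _))"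
proof (intro equalityI subsetI)
  fix l :: "('a ^ 3) set set" assume "l \<in> {l \<in> pg_lines. point_infinity \<in> l}"
  then have "l \<in> pg_lines" "point_infinity \<in> l" by auto
  then show "l \<in> insert line_infinity (range vertical_line)"
    by (cases l rule: line_cases) auto
qed auto

lemma lines_avoiding_infinity:
  "{l \<in> pg_lines. point_infinity \<notin> l} =
    range (\<lambda>(m :: 'a::{field,finite}, b). graph_line m b)"
proof (intro equalityI subsetI)
  fix l :: "('a ^ 3) set set" assume "l \<in> {l \<in> pg_lines. point_infinity \<notin> l}"
  then have "l \<in> pg_lines" "point_infinity \<notin> l" by auto
  then show "l \<in> range (\<lambda>(m, b). graph_line m b)"
    by (cases l rule: line_cases) auto
qed auto

lemma line_infinity_neq_vertical: "line_infinity \<noteq> vertical_line a"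
  by (metis incidence_simps(1,2))

lemma line_infinity_Int:
  "line_infinity \<inter> insert point_infinity (affine_point ` A) = {point_infinity}"
  by auto

lemma card_vertical_line_Int:
  fixes A :: "('a::{field,finite} \<times> 'a) set"
  shows "card (vertical_line a \<inter> insert point_infinity (affine_point ` A)) =
    Suc (card {y. (a, y) \<in> A})"
proof -
  have "vertical_line a \<inter> insert point_infinity (affine_point ` A) =
      insert point_infinity (affine_point ` Pair a ` {y. (a, y) \<in> A})"
    by auto
  moreover have "card (affine_point ` Pair a ` {y. (a, y) \<in> A}) = card {y. (a, y) \<in> A}"
    by (simp add: card_image inj_on_subset[OF inj_affine_point] inj_on_def[of "Pair a"])
  moreover have "point_infinity \<notin> affine_point ` Pair a ` {y. (a, y) \<in> A}"
    by (rule point_infinity_not_affine)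
  ultimately show ?thesis by simp
qed

lemma card_graph_line_Int:
  fixes A :: "('a::{field,finite} \<times> 'a) set"
  shows "card (graph_line m b \<inter> insert point_infinity (affine_point ` A)) =
    card {x. (x, m * x + b) \<in> A}"
proof -
  have "graph_line m b \<inter> insert point_infinity (affine_point ` A) =
      affine_point ` (\<lambda>x. (x, m * x + b)) ` {x. (x, m * x + b) \<in> A}"
    unfolding image_image by auto
  then show ?thesis
    by (simp add: card_image inj_on_subset[OF inj_affine_point] inj_on_def[of "\<lambda>x. (x, m * x + b)"])
qed

lemma card_lines_avoiding_infinity:
  fixes A :: "('a::{field,finite} \<times> 'a) set"
  shows "card {l \<in> pg_lines. point_infinity \<notin> l \<and>
      card (l \<inter> insert point_infinity (affine_point ` A)) = k} =
    card {(m, b). card {x. (x, m * x + b) \<in> A} = k}"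
    (is "card ?L = card ?B")
proof -
  have "?L = (\<lambda>(m, b). graph_line m b) ` ?B"
  proof (intro equalityI subsetI)
    fix l assume l: "l \<in> ?L"
    then have "l \<in> range (\<lambda>(m, b). graph_line m b)"
      using lines_avoiding_infinity by blast
    then obtain m b where mb: "l = graph_line m b" by auto
    with l have "(m, b) \<in> ?B" by (simp only: card_graph_line_Int mem_Collect_eq prod.case)
    with mb show "l \<in> (\<lambda>(m, b). graph_line m b) ` ?B" by force
  next
    fix l assume "l \<in> (\<lambda>(m, b). graph_line m b) ` ?B"
    then obtain m b where "l = graph_line m b" "card {x. (x, m * x + b) \<in> A} = k" by auto
    then show "l \<in> ?L" by (simp only: card_graph_line_Int mem_Collect_eq) simp
  qed
  then show ?thesis
    by (simp add: card_image inj_on_subset[OF inj_graph_line])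
qed

lemma card_affine_set:
  fixes A :: "('a::{field,finite} \<times> 'a) set"
  shows "card (insert point_infinity (affine_point ` A)) = Suc (card A)"
  by (simp add: point_infinity_not_affine card_image inj_on_subset[OF inj_affine_point])

text \<open>
  The pencil through \<open>(0 : 1 : 0)\<close> consists of the line at infinity and the vertical lines, and the
  remaining lines are the graphs \<open>y = m x + b\<close>.  For a set with \<open>(0 : 1 : 0)\<close> as its only point at
  infinity, this leaves only a count of pairs \<open>(m, b)\<close> in the affine plane.
\<close>

lemma weight_enumerator_affine_cong:
  fixes A :: "('a::{field,finite} \<times> 'a) set"
  assumes C: "is_projective_code (insert point_infinity (affine_point ` A)) C"
    and A: "(x1, y1) \<in> A" "(x2, y2) \<in> A" "x1 \<noteq> x2"
    and dvd: "\<And>k. n dvd card {(m, b). card {x. (x, m * x + b) \<in> A} = k}"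
  shows "poly_cong (int n) (weight_enumerator (card (insert point_infinity (affine_point ` A))) C)
    (1 + smult (int CARD('a) - 1)
      (monom 1 (card A) + (\<Sum>a\<in>UNIV. monom 1 (card A - card {y. (a, y) \<in> A}))))"
proof -
  let ?X = "insert point_infinity (affine_point ` A)"
  let ?m = "\<lambda>l. monom (1::int) (card ?X - card (l \<inter> ?X))"
  have X: "?X \<subseteq> pg_points"
    using affine_point_in_pg_points point_infinity_in_pg_points by auto
  have noncol: "\<forall>l\<in>pg_lines. \<not> ?X \<subseteq> l"
  proof (intro ballI notI)
    fix l assume l: "l \<in> pg_lines" "?X \<subseteq> l"
    then have "point_infinity \<in> l" "affine_point (x1, y1) \<in> l" "affine_point (x2, y2) \<in> l"
      using A by auto
    with l(1) A(3) show False by (cases l rule: line_cases) auto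
  qed
  have "(\<Sum>l | l \<in> pg_lines \<and> point_infinity \<in> l. ?m l) =
      ?m line_infinity + sum ?m (range vertical_line)"
    unfolding lines_through_infinity
    by (rule sum.insert) (use line_infinity_neq_vertical in auto)
  also have "sum ?m (range vertical_line) =
      (\<Sum>a\<in>UNIV. monom 1 (card A - card {y. (a, y) \<in> A}))"
    unfolding sum.reindex[OF inj_vertical_line] comp_def card_affine_set card_vertical_line_Int
    by simp
  also have "?m line_infinity = monom 1 (card A)"
    unfolding line_infinity_Int by (simp add: card_affine_set)
  finally have pencil: "(\<Sum>l | l \<in> pg_lines \<and> point_infinity \<in> l. ?m l) =
      monom 1 (card A) + (\<Sum>a\<in>UNIV. monom 1 (card A - card {y. (a, y) \<in> A}))" .
  have "n dvd card {l \<in> pg_lines. point_infinity \<notin> l \<and> card (l \<inter> ?X) = k}" for k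
    unfolding card_lines_avoiding_infinity by (rule dvd)
  from weight_enumerator_cong_pencil[OF X noncol C this] show ?thesis
    unfolding pencil .
qed

section \<open>Curves given by trace and norm\<close>

text \<open>
  Multiplication by \<open>x \<noteq> 0\<close> permutes the nonzero elements, so the product of these elements does not
  change when it is multiplied by \<open>x^(Q - 1)\<close>.
\<close>

lemma field_power_card: "(x :: 'a::{field,finite}) ^ CARD('a) = x"
proof (cases "x = 0")
  case False
  let ?P = "\<Prod>y\<in>UNIV - {0::'a}. y"
  have "?P = (\<Prod>y\<in>UNIV - {0}. x * y)"
    by (rule prod.reindex_bij_witness[of _ "\<lambda>y. x * y" "\<lambda>y. y / x"]) (use False in auto)
  also have "\<dots> = x ^ (CARD('a) - 1) * ?P"
    by (simp add: prod.distrib)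
  finally have "x ^ (CARD('a) - 1) = 1" by simp
  then have "x ^ Suc (CARD('a) - 1) = x" by (simp only: power_Suc mult_1_right)
  then show ?thesis by (simp only: Suc_diff_1[OF zero_less_card_finite])
qed simp

text \<open>
  The translation by \<open>1\<close> permutes the field, so it does not change the sum of all elements.
\<close>

lemma of_nat_card_field: "of_nat CARD('a) = (0 :: 'a::{field,finite})"
proof -
  have "(\<Sum>x\<in>UNIV. x) = (\<Sum>x\<in>UNIV. x + (1::'a))"
    by (rule sum.reindex_bij_witness[of _ "\<lambda>x. x + 1" "\<lambda>x. x - 1"]) auto
  then show ?thesis by (simp add: sum.distrib)
qed

text \<open>
  Here the field has \<open>q\<^sup>2\<close> elements.  Its subfield \<open>GF(q)\<close> appears only as the set of fixed points of
  \<open>x \<mapsto> x^q\<close>.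
\<close>

context
  fixes q :: nat
  assumes q: "primepow q" and card_a: "CARD('a::{field,finite}) = q ^ 2"
begin

text \<open>
  The characteristic is a prime that divides the number \<open>q\<^sup>2\<close> of elements, so \<open>q\<close> is a power of it.
\<close>

lemma power_q_add: "(x + y :: 'a) ^ q = x ^ q + y ^ q"
proof -
  obtain p k where pk: "prime p" "q = p ^ k" using q by (auto simp: primepow_def)
  have "prime CHAR('a)"
    by (rule prime_CHAR_semidom) (rule finite_imp_CHAR_pos, simp)
  moreover have "CHAR('a) dvd p ^ (k * 2)"
    using of_nat_card_field[where 'a = 'a]
    by (simp only: of_nat_eq_0_iff_char_dvd card_a pk power_mult)
  ultimately have "CHAR('a) = p"
    using pk(1) by (metis prime_dvd_power primes_dvd_imp_eq)
  then show ?thesis using freshmans_dream'[of q k x y] pk \<open>prime CHAR('a)\<close> by simp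
qed

lemma power_q_q: "((x :: 'a) ^ q) ^ q = x"
proof -
  have "(x ^ q) ^ q = x ^ CARD('a)" by (simp add: card_a power2_eq_square flip: power_mult)
  then show ?thesis by (simp add: field_power_card)
qed

lemma rel_trace_add: "rel_trace q (x + y :: 'a) = rel_trace q x + rel_trace q y"
  by (simp add: rel_trace_def power_q_add)

lemma rel_trace_diff: "rel_trace q (x - y :: 'a) = rel_trace q x - rel_trace q y"
  using rel_trace_add[of "x - y" y] by simp

lemma rel_trace_fixed: "rel_trace q (x :: 'a) ^ q = rel_trace q x"
  by (simp add: rel_trace_def power_q_add power_q_q)

lemma rel_norm_fixed: "rel_norm q (x :: 'a) ^ q = rel_norm q x"
  by (simp add: rel_norm_def power_mult_distrib power_q_q mult.commute)

text \<open>
  The kernel of the trace consists of roots of \<open>x^q + x\<close>, and its image of roots of \<open>x^q - x\<close>.  Each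
  has therefore at most \<open>q\<close> elements; but the product of their sizes is \<open>q\<^sup>2\<close>, so both bounds are
  attained.
\<close>

lemma card_rel_trace_fibre:
  assumes "c ^ q = (c :: 'a)"
  shows "card {x. rel_trace q x = c} = q"
proof -
  have q2: "q \<ge> 2" using q by (simp add: primepow_gt_Suc_0 Suc_leI numeral_2_eq_2)
  let ?K = "{x :: 'a. rel_trace q x = 0}" and ?F = "{x :: 'a. x ^ q = x}"
  have deg: "degree (monom 1 q + [:0, e:]) = q" for e :: 'a
    using q2 by (subst degree_add_eq_left) (auto simp: degree_monom_eq)
  have roots: "card {x. poly (monom 1 q + [:0, e:]) x = 0} \<le> q" for e :: 'a
  proof -
    have "monom 1 q + [:0, e:] \<noteq> 0" using deg[of e] q2 by auto
    then show ?thesis using card_poly_roots_bound[of "monom 1 q + [:0, e:]"] deg[of e] by simp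
  qed
  have K: "card ?K \<le> q"
    using roots[of 1] by (simp add: rel_trace_def poly_monom add.commute)
  have F: "card ?F \<le> q"
    using roots[of "- 1"] by (simp add: poly_monom)
  have fib: "card {x \<in> UNIV. rel_trace q x = d} = card ?K" if d: "d \<in> range (rel_trace q)" for d :: 'a
  proof -
    obtain z where z: "d = rel_trace q z" using d by auto
    show ?thesis
      using card_shift[of "\<lambda>x. rel_trace q x = d" z] by (simp add: rel_trace_add z)
  qed
  have prod: "q * q = card ?K * card (range (rel_trace q :: 'a \<Rightarrow> 'a))"
    using card_eq_mult_card_image[of "UNIV :: 'a set" "rel_trace q" "card ?K"] fib
    by (simp add: card_a power2_eq_square)
  have sub: "range (rel_trace q) \<subseteq> ?F" by (auto simp: rel_trace_fixed)
  then have R: "card (range (rel_trace q :: 'a \<Rightarrow> 'a)) \<le> card ?F" by (intro card_mono) auto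
  have "q * q \<le> q * card (range (rel_trace q :: 'a \<Rightarrow> 'a))"
    unfolding prod using K by (rule mult_right_mono) simp
  then have R': "card (range (rel_trace q :: 'a \<Rightarrow> 'a)) = q"
    using q2 R F by simp
  then have Kq: "card ?K = q" using prod q2 by simp
  have "range (rel_trace q) = ?F"
    using R R' F sub by (intro card_subset_eq) auto
  then show ?thesis using fib[of c] assms Kq by auto
qed

lemma rel_trace_surj:
  assumes "c ^ q = (c :: 'a)"
  shows "\<exists>x. rel_trace q x = c"
proof (rule ccontr)
  assume "\<nexists>x. rel_trace q x = c"
  then have "card {x. rel_trace q x = c} = 0" by simp
  then show False using card_rel_trace_fibre[OF assms] primepow_gt_Suc_0[OF q] by simp
qed

text \<open>
  Choose \<open>a\<close> with \<open>a^q = m\<close>.  In the norm of \<open>x + a\<close> the mixed terms are the trace of \<open>m x\<close>, and they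
  cancel the slope on the other side of the equation.  So the lines of slope \<open>m\<close> are equivalent to
  those of slope \<open>0\<close>, up to the shift \<open>e\<close> of the intercept, and it is enough to count the latter.
\<close>

lemma card_curve_lines:
  fixes f :: "'a \<Rightarrow> 'a"
  assumes f: "Modules.additive f"
  shows "q ^ 3 dvd card {(m, b). card {x. rel_trace q (m * x + b + f x) = rel_norm q x} = k}"
proof -
  let ?s = "\<lambda>m b. card {x. rel_trace q (m * x + b + f x) = rel_norm q x}"
  let ?B = "{b. ?s 0 b = k}"
  have slope: "card {b. ?s m b = k} = card ?B" for m
  proof -
    define a where "a = m ^ q"
    have a: "a ^ q = m" by (simp add: a_def power_q_q)
    \<comment> \<open>An element of trace \<open>N(a)\<close> absorbs the constant term of the norm into the intercept.\<close>
    obtain d where d: "rel_trace q d = rel_norm q a"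
      using rel_trace_surj[OF rel_norm_fixed[of a]] by blast
    define e where "e = m * a + f a - d"
    have norm: "rel_norm q (x + a) = rel_norm q x + rel_trace q (m * x) + rel_norm q a" for x
      by (simp add: rel_norm_def rel_trace_def power_q_add power_mult_distrib a power_q_q a_def algebra_simps)
    have "(rel_trace q (m * (x + a) + b + f (x + a)) = rel_norm q (x + a)) \<longleftrightarrow>
        (rel_trace q (0 * x + (b + e) + f x) = rel_norm q x)" for x b
      by (simp only: e_def norm additive.add[OF f] rel_trace_add rel_trace_diff d distrib_left
          mult_zero_left add_0_left) (simp add: algebra_simps)
    then have "?s m b = ?s 0 (b + e)" for b
      using card_shift[of "\<lambda>x. rel_trace q (m * x + b + f x) = rel_norm q x" a] by simp
    then show ?thesis using card_shift[of "\<lambda>b. ?s 0 b = k" e] by simp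
  qed
  have "card ?B = q * card (rel_trace q ` ?B)"
  proof (rule card_eq_mult_card_image)
    fix c assume "c \<in> rel_trace q ` ?B"
    then obtain b where b: "b \<in> ?B" "c = rel_trace q b" by blast
    have "b' \<in> ?B" if "rel_trace q b' = c" for b'
      using b that by (simp add: rel_trace_add)
    then have "{b \<in> ?B. rel_trace q b = c} = {b. rel_trace q b = c}" by blast
    then show "card {b \<in> ?B. rel_trace q b = c} = q"
      using card_rel_trace_fibre[of c] b rel_trace_fixed by simp
  qed simp
  moreover have "card {(m, b). ?s m b = k} = q ^ 2 * card ?B"
    using card_pairs_eq_sum[of UNIV "\<lambda>m b. ?s m b = k"] slope by (simp add: card_a)
  ultimately show ?thesis by (simp add: power3_eq_cube power2_eq_square)
qed

text \<open>
  The line at infinity is a tangent and the \<open>q\<^sup>2\<close> vertical lines are \<open>(q + 1)\<close>-secants, so the pencil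
  contributes the coefficients \<open>q\<^sup>2 - 1\<close> and \<open>(q\<^sup>2 - 1) q\<^sup>2\<close>, and the latter is \<open>- q\<^sup>2\<close> modulo \<open>q\<^sup>3\<close>.
\<close>

lemma curve_weight_enumerator_cong:
  fixes f :: "'a \<Rightarrow> 'a"
  assumes f: "Modules.additive f" and C: "is_projective_code (curve_points q f) C"
  shows "poly_cong (int (q ^ 3)) (weight_enumerator (card (curve_points q f)) C)
    (1 - monom (int (q ^ 2)) (q ^ 3 - q) + monom (int (q ^ 2) - 1) (q ^ 3))"
proof -
  let ?A = "{(x, y). rel_trace q (y + f x) = rel_norm q x}"
  have q2: "q \<ge> 2" using q by (simp add: primepow_gt_Suc_0 Suc_leI numeral_2_eq_2)
  have fibre: "card {y. (x, y) \<in> ?A} = q" for x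
    using card_shift[of "\<lambda>y. rel_trace q y = rel_norm q x" "f x"]
      card_rel_trace_fibre[OF rel_norm_fixed[of x]] by simp
  have cardA: "card ?A = q ^ 3"
    using card_pairs_eq_sum[of UNIV "\<lambda>x y. rel_trace q (y + f x) = rel_norm q x"] fibre
    by (simp add: card_a power3_eq_cube power2_eq_square)
  have ex: "\<exists>y. (x, y) \<in> ?A" for x
  proof (rule ccontr)
    assume "\<nexists>y. (x, y) \<in> ?A"
    then have "{y. (x, y) \<in> ?A} = {}" by blast
    with fibre[of x] q2 show False by (simp only: card.empty)
  qed
  obtain y0 where y0: "(0, y0) \<in> ?A" using ex[of 0] by (rule exE)
  obtain y1 where y1: "(1, y1) \<in> ?A" using ex[of 1] by (rule exE)
  have X: "curve_points q f = insert point_infinity (affine_point ` ?A)"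
    by (simp add: curve_points_def)
  have dvd: "q ^ 3 dvd card {(m, b). card {x. (x, m * x + b) \<in> ?A} = k}" for k
    using card_curve_lines[OF f, of k] by simp
  have "poly_cong (int (q ^ 3)) (weight_enumerator (card (curve_points q f)) C)
    (1 + smult (int CARD('a) - 1)
      (monom 1 (card ?A) + (\<Sum>a\<in>UNIV. monom 1 (card ?A - card {y. (a, y) \<in> ?A}))))"
    using weight_enumerator_affine_cong[OF C[unfolded X] y0 y1 zero_neq_one dvd] unfolding X .
  moreover have "(\<Sum>a\<in>UNIV. monom 1 (card ?A - card {y. (a, y) \<in> ?A})) = monom (int (q ^ 2)) (q ^ 3 - q)"
    unfolding fibre cardA sum_monom_const card_a ..
  ultimately have "poly_cong (int (q ^ 3)) (weight_enumerator (card (curve_points q f)) C)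
    (1 + smult (int (q ^ 2) - 1) (monom 1 (q ^ 3) + monom (int (q ^ 2)) (q ^ 3 - q)))"
    unfolding cardA card_a by (simp only:)
  moreover have "poly_cong (int (q ^ 3))
      (1 + smult (int (q ^ 2) - 1) (monom 1 (q ^ 3) + monom (int (q ^ 2)) (q ^ 3 - q)))
      (1 - monom (int (q ^ 2)) (q ^ 3 - q) + monom (int (q ^ 2) - 1) (q ^ 3))"
  proof -
    have "1 + smult (int (q ^ 2) - 1) (monom 1 (q ^ 3) + monom (int (q ^ 2)) (q ^ 3 - q)) -
      (1 - monom (int (q ^ 2)) (q ^ 3 - q) + monom (int (q ^ 2) - 1) (q ^ 3)) =
      [:int (q ^ 3):] * monom (int q) (q ^ 3 - q)"
      by (simp add: poly_eq_iff algebra_simps power3_eq_cube power2_eq_square)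
    then show ?thesis unfolding poly_cong_iff_dvd by (simp only: dvd_triv_left)
  qed
  ultimately show ?thesis by (rule poly_cong_trans)
qed

end

section \<open>Lifting along a subspace\<close>

text \<open>
  The scalars \<open>c \<in> GF(q)\<close> act on the larger field by \<open>x \<mapsto> \<phi> c * x\<close>, and \<open>I\<close> is a subspace for this
  action which meets the scalars only in \<open>0\<close>.
\<close>

context
  fixes \<phi> :: "'k::{field,finite} \<Rightarrow> 'a::{field,finite}" and I :: "'a set" and S :: "('k \<times> 'k) set"
  assumes emb: "is_field_embedding \<phi>"
    and sub: "module.subspace (\<lambda>c x. \<phi> c * x) I"
    and I_range: "I \<inter> range \<phi> = {0}"
begin

lemma emb_simps:
  "\<phi> 1 = 1" "\<phi> (x + y) = \<phi> x + \<phi> y" "\<phi> (x * y) = \<phi> x * \<phi> y" "\<phi> 0 = 0" "\<phi> (x - y) = \<phi> x - \<phi> y"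
proof -
  show add: "\<phi> (x + y) = \<phi> x + \<phi> y" for x y
    using emb by (simp add: is_field_embedding_def)
  show "\<phi> 1 = 1" "\<phi> (x * y) = \<phi> x * \<phi> y"
    using emb by (simp_all add: is_field_embedding_def)
  show "\<phi> 0 = 0" using add[of 0 0] by (metis add_0_right add_left_cancel)
  show "\<phi> (x - y) = \<phi> x - \<phi> y" using add[of "x - y" y] by simp
qed

lemma emb_eq_0_iff: "\<phi> x = 0 \<longleftrightarrow> x = 0"
proof
  assume "\<phi> x = 0"
  then have "\<phi> (x * inverse x) = 0" by (simp add: emb_simps)
  then show "x = 0" using emb_simps(1) by (cases "x = 0") auto
qed (simp add: emb_simps)

lemma inj_emb: "inj \<phi>"
proof (rule injI)
  fix x y assume "\<phi> x = \<phi> y"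
  then show "x = y" using emb_eq_0_iff[of "x - y"] by (simp add: emb_simps)
qed

interpretation V: vector_space "\<lambda>c x. \<phi> c * x"
  by unfold_locales (simp_all add: emb_simps algebra_simps)

text \<open>
  The direct sum \<open>GF(q) \<oplus> I\<close>, which contains the ordinates of all lifted points.
\<close>

definition base_sum where "base_sum = {x + y |x y. x \<in> range \<phi> \<and> y \<in> I}"

lemma emb_in_I_iff: "\<phi> x \<in> I \<longleftrightarrow> x = 0"
  using I_range V.subspace_0[OF sub] emb_eq_0_iff by (auto simp: emb_simps)

lemma subspace_base_sum: "V.subspace base_sum"
proof -
  have "V.subspace (range \<phi>)"
    by (rule V.subspaceI) (auto simp: emb_simps(4)[symmetric] simp flip: emb_simps(2,3))
  then show ?thesis unfolding base_sum_def by (rule V.subspace_sums[OF _ sub])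
qed

lemma inj_on_split: "inj_on (\<lambda>(c, i). \<phi> c + i) (UNIV \<times> I)"
proof (rule inj_onI, clarsimp)
  fix c i d j assume ij: "i \<in> I" "j \<in> I" and eq: "\<phi> c + i = \<phi> d + j"
  have "\<phi> (c - d) = j - i" using eq by (simp add: emb_simps algebra_simps)
  then have "\<phi> (c - d) \<in> I" using V.subspace_diff[OF sub ij(2,1)] by simp
  then have "c = d" by (simp add: emb_in_I_iff)
  then show "c = d \<and> i = j" using eq by simp
qed

lemma base_sum_eq_image: "base_sum = (\<lambda>(c, i). \<phi> c + i) ` (UNIV \<times> I)"
  by (auto simp: base_sum_def image_iff)

lemma card_I: "card I = CARD('k) ^ V.dim I"
  by (rule V.card_subspace[OF sub finite])

lemma card_base_sum: "card base_sum = CARD('k) ^ (V.dim I + 1)"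
  unfolding base_sum_eq_image by (simp add: card_image[OF inj_on_split] card_cartesian_product card_I)

lemma in_lifted_set_iff: "(\<phi> x, w) \<in> lifted_set \<phi> I S \<longleftrightarrow> (\<exists>y. (x, y) \<in> S \<and> w - \<phi> y \<in> I)"
proof
  assume "(\<phi> x, w) \<in> lifted_set \<phi> I S"
  then obtain x' y i where "\<phi> x = \<phi> x'" "w = \<phi> y + i" "i \<in> I" "(x', y) \<in> S"
    by (auto simp: lifted_set_def)
  then have "(x, y) \<in> S" "w - \<phi> y \<in> I" using injD[OF inj_emb, of x x'] by auto
  then show "\<exists>y. (x, y) \<in> S \<and> w - \<phi> y \<in> I" by blast
next
  assume "\<exists>y. (x, y) \<in> S \<and> w - \<phi> y \<in> I"
  then obtain y where "(x, y) \<in> S" "w - \<phi> y \<in> I" by blast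
  then show "(\<phi> x, w) \<in> lifted_set \<phi> I S"
    unfolding lifted_set_def by (intro CollectI exI[of _ x] exI[of _ y] exI[of _ "w - \<phi> y"]) simp
qed

lemma lifted_set_abscissa: "(z, w) \<in> lifted_set \<phi> I S \<Longrightarrow> z \<in> range \<phi>"
  by (auto simp: lifted_set_def)

lemma card_lifted_fibre: "card {w. (\<phi> x, w) \<in> lifted_set \<phi> I S} = card {y. (x, y) \<in> S} * card I"
proof -
  have "{w. (\<phi> x, w) \<in> lifted_set \<phi> I S} = (\<lambda>(c, i). \<phi> c + i) ` ({y. (x, y) \<in> S} \<times> I)"
  proof (intro equalityI subsetI)
    fix w assume "w \<in> {w. (\<phi> x, w) \<in> lifted_set \<phi> I S}"
    then obtain y where "(x, y) \<in> S" "w - \<phi> y \<in> I" by (auto simp: in_lifted_set_iff)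
    then show "w \<in> (\<lambda>(c, i). \<phi> c + i) ` ({y. (x, y) \<in> S} \<times> I)"
      by (intro image_eqI[of _ _ "(y, w - \<phi> y)"]) auto
  qed (auto simp: in_lifted_set_iff)
  moreover have "inj_on (\<lambda>(c, i). \<phi> c + i) ({y. (x, y) \<in> S} \<times> I)"
    by (rule inj_on_subset[OF inj_on_split]) auto
  ultimately show ?thesis by (simp add: card_image card_cartesian_product)
qed

text \<open>
  The abscissae, taken in \<open>GF(q)\<close>, of the lifted points on \<open>y = m x + b\<close>.
\<close>

definition line_abscissae where "line_abscissae m b = {x. \<exists>y. (x, y) \<in> S \<and> m * \<phi> x + b - \<phi> y \<in> I}"

lemma card_lifted_line: "card {z. (z, m * z + b) \<in> lifted_set \<phi> I S} = card (line_abscissae m b)"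
proof -
  have "{z. (z, m * z + b) \<in> lifted_set \<phi> I S} = \<phi> ` line_abscissae m b"
  proof (intro equalityI subsetI)
    fix z assume z: "z \<in> {z. (z, m * z + b) \<in> lifted_set \<phi> I S}"
    then obtain x where "z = \<phi> x" using lifted_set_abscissa by blast
    with z show "z \<in> \<phi> ` line_abscissae m b" by (auto simp: line_abscissae_def in_lifted_set_iff)
  qed (auto simp: line_abscissae_def in_lifted_set_iff)
  then show ?thesis by (simp add: card_image inj_on_subset[OF inj_emb])
qed

lemma line_abscissae_inside:
  assumes "i \<in> I" "j \<in> I"
  shows "line_abscissae (\<phi> m + i) (\<phi> b + j) = {x. (x, m * x + b) \<in> S}"
proof -
  have "(\<phi> m + i) * \<phi> x + (\<phi> b + j) - \<phi> y \<in> I \<longleftrightarrow> y = m * x + b" for x y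
  proof -
    have ij: "\<phi> x * i + j \<in> I"
      using V.subspace_add[OF sub V.subspace_scale[OF sub assms(1)] assms(2)] .
    have "(\<phi> m + i) * \<phi> x + (\<phi> b + j) - \<phi> y = \<phi> (m * x + b - y) + (\<phi> x * i + j)"
      by (simp add: emb_simps algebra_simps)
    also have "\<dots> \<in> I \<longleftrightarrow> \<phi> (m * x + b - y) \<in> I"
      using V.subspace_add[OF sub _ ij] V.subspace_diff[OF sub _ ij] by (metis add_diff_cancel_right')
    also have "\<dots> \<longleftrightarrow> y = m * x + b" by (auto simp: emb_in_I_iff)
    finally show ?thesis .
  qed
  then show ?thesis by (auto simp: line_abscissae_def)
qed

lemma line_abscissae_outside:
  assumes "m \<in> base_sum" "b \<notin> base_sum"
  shows "line_abscissae m b = {}"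
proof -
  have "b \<in> base_sum" if "m * \<phi> x + b - \<phi> y \<in> I" for x y
  proof -
    have "\<phi> x * m \<in> base_sum" by (rule V.subspace_scale[OF subspace_base_sum assms(1)])
    moreover have "\<phi> y + (m * \<phi> x + b - \<phi> y) \<in> base_sum"
      unfolding base_sum_def using that by blast
    ultimately have "\<phi> y + (m * \<phi> x + b - \<phi> y) - \<phi> x * m \<in> base_sum"
      by (intro V.subspace_diff[OF subspace_base_sum])
    then show ?thesis by (simp add: mult.commute)
  qed
  then show ?thesis using assms(2) by (auto simp: line_abscissae_def)
qed

text \<open>
  Two points of the lifted set with distinct abscissae in \<open>GF(q)\<close> and ordinates in \<open>GF(q) \<oplus> I\<close> are
  joined by a line whose slope is again in \<open>GF(q) \<oplus> I\<close>.  For any other slope, different lifted points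
  thus lie on different lines; \<open>G\<close> is the set of the intercepts of these lines.
\<close>

lemma card_line_abscissae_steep:
  assumes m: "m \<notin> base_sum"
  shows "\<exists>G. card G = card S * card I \<and> (\<forall>b. card (line_abscissae m b) = (if b \<in> G then 1 else 0))"
proof -
  let ?g = "\<lambda>((x, y), i). \<phi> y + i - m * \<phi> x"
  have uniq: "x = x'" if "\<phi> y + i - m * \<phi> x = \<phi> y' + i' - m * \<phi> x'" "i \<in> I" "i' \<in> I" for x y i x' y' i'
  proof (rule ccontr)
    assume "x \<noteq> x'"
    have "m * \<phi> (x - x') = \<phi> (y - y') + (i - i')"
      using that(1) by (simp add: emb_simps algebra_simps)
    then have "m * \<phi> (x - x') \<in> base_sum"
      using V.subspace_diff[OF sub that(2,3)] by (auto simp: base_sum_def)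
    then have "\<phi> (inverse (x - x')) * (m * \<phi> (x - x')) \<in> base_sum"
      by (rule V.subspace_scale[OF subspace_base_sum])
    also have "\<phi> (inverse (x - x')) * (m * \<phi> (x - x')) = m * \<phi> (inverse (x - x') * (x - x'))"
      by (simp only: emb_simps(3) ac_simps)
    also have "\<dots> = m" using \<open>x \<noteq> x'\<close> by (simp add: emb_simps)
    finally show False using m by simp
  qed
  have inj: "inj_on ?g (S \<times> I)"
  proof (rule inj_onI, clarsimp)
    fix x y i x' y' i'
    assume i: "i \<in> I" "i' \<in> I" and eq: "\<phi> y + i - m * \<phi> x = \<phi> y' + i' - m * \<phi> x'"
    have x: "x = x'" using uniq[OF eq i] .
    then have "\<phi> y + i = \<phi> y' + i'" using eq by simp
    then show "x = x' \<and> y = y' \<and> i = i'"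
      using x inj_onD[OF inj_on_split, of "(y, i)" "(y', i')"] i by simp
  qed
  have mem: "x \<in> line_abscissae m b \<longleftrightarrow> (\<exists>y i. (x, y) \<in> S \<and> i \<in> I \<and> b = \<phi> y + i - m * \<phi> x)" for x b
  proof
    assume "x \<in> line_abscissae m b"
    then obtain y where "(x, y) \<in> S" "m * \<phi> x + b - \<phi> y \<in> I" by (auto simp: line_abscissae_def)
    then show "\<exists>y i. (x, y) \<in> S \<and> i \<in> I \<and> b = \<phi> y + i - m * \<phi> x"
      by (intro exI[of _ y] exI[of _ "m * \<phi> x + b - \<phi> y"]) simp
  qed (auto simp: line_abscissae_def)
  have "card (line_abscissae m b) = (if b \<in> ?g ` (S \<times> I) then 1 else 0)" for b
  proof (cases "b \<in> ?g ` (S \<times> I)")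
    case True
    then obtain x y i where xyi: "(x, y) \<in> S" "i \<in> I" "b = \<phi> y + i - m * \<phi> x" by auto
    have "x' = x" if x': "x' \<in> line_abscissae m b" for x'
    proof -
      obtain y' i' where "i' \<in> I" "b = \<phi> y' + i' - m * \<phi> x'"
        using mem[of x' b] x' by blast
      then show ?thesis using uniq[of y' i' x' y i x] xyi by simp
    qed
    moreover have "x \<in> line_abscissae m b" using mem[of x b] xyi by blast
    ultimately have "line_abscissae m b = {x}" by blast
    then show ?thesis using True by simp
  next
    case False
    have "x \<notin> line_abscissae m b" for x
    proof
      assume "x \<in> line_abscissae m b"
      then obtain y i where "(x, y) \<in> S" "i \<in> I" "b = \<phi> y + i - m * \<phi> x"
        using mem[of x b] by blast
      then have "b \<in> ?g ` (S \<times> I)" by (intro image_eqI[of _ _ "((x, y), i)"]) auto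
      with False show False by simp
    qed
    then have "line_abscissae m b = {}" by blast
    then show ?thesis using False by simp
  qed
  then show ?thesis
    by (intro exI[of _ "?g ` (S \<times> I)"]) (simp add: card_image[OF inj] card_cartesian_product)
qed

text \<open>
  Adding elements of \<open>I\<close> to the slope and to the intercept does not change the abscissae, so each line
  over \<open>GF(q)\<close> is counted \<open>|I|\<^sup>2\<close> times.
\<close>

lemma card_lines_base_sum:
  "card {(m, b). m \<in> base_sum \<and> b \<in> base_sum \<and> card (line_abscissae m b) = k} =
    card {(m, b). card {x. (x, m * x + b) \<in> S} = k} * (card I * card I)"
    (is "card ?A = card ?B * _")
proof -
  let ?g = "\<lambda>((m, b), (i, j)). (\<phi> m + i, \<phi> b + j)"
  have "?A = ?g ` (?B \<times> (I \<times> I))"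
  proof (intro equalityI subsetI)
    fix p assume p: "p \<in> ?A"
    then have mem: "fst p \<in> base_sum" "snd p \<in> base_sum" by auto
    obtain m i where m: "fst p = \<phi> m + i" "i \<in> I" using mem(1) by (auto simp: base_sum_eq_image)
    obtain b j where b: "snd p = \<phi> b + j" "j \<in> I" using mem(2) by (auto simp: base_sum_eq_image)
    have p': "p = (\<phi> m + i, \<phi> b + j)" using m b by (simp add: prod_eq_iff)
    have "card (line_abscissae (\<phi> m + i) (\<phi> b + j)) = k" using p unfolding p' by simp
    then have "(m, b) \<in> ?B" using m b by (simp add: line_abscissae_inside)
    then show "p \<in> ?g ` (?B \<times> (I \<times> I))"
      using m b by (intro image_eqI[of _ _ "((m, b), (i, j))"]) (auto simp: p')
  next
    fix p assume "p \<in> ?g ` (?B \<times> (I \<times> I))"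
    then obtain m b i j where "card {x. (x, m * x + b) \<in> S} = k" "i \<in> I" "j \<in> I"
        "p = (\<phi> m + i, \<phi> b + j)" by auto
    then show "p \<in> ?A" by (auto simp: line_abscissae_inside base_sum_eq_image)
  qed
  moreover have "inj_on ?g (?B \<times> (I \<times> I))"
  proof (rule inj_onI, clarsimp)
    fix m b i j m' b' i' j'
    assume "i \<in> I" "j \<in> I" "i' \<in> I" "j' \<in> I"
      and "\<phi> m + i = \<phi> m' + i'" "\<phi> b + j = \<phi> b' + j'"
    then show "m = m' \<and> b = b' \<and> i = i' \<and> j = j'"
      using inj_onD[OF inj_on_split, of "(m, i)" "(m', i')"]
        inj_onD[OF inj_on_split, of "(b, j)" "(b', j')"] by simp
  qed
  ultimately show ?thesis by (simp add: card_image card_cartesian_product)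
qed

text \<open>
  The lines are split by whether the slope and the intercept lie in \<open>GF(q) \<oplus> I\<close>.  If both do, \<open>q^(2s)\<close>
  comes from the translations by \<open>I\<close> and the last factor \<open>q\<close> from \<open>S\<close>.  Otherwise one factor
  \<open>q^(s+1)\<close> comes from the slopes and another from the intercepts.
\<close>

lemma dvd_card_lifted_lines:
  assumes fib: "\<And>x. card {y. (x, y) \<in> S} = t"
    and dvd: "CARD('k) dvd card {(m, b). card {x. (x, m * x + b) \<in> S} = k}"
  shows "CARD('k) ^ (2 * V.dim I + 1) dvd
    card {(m, b). card {z. (z, m * z + b) \<in> lifted_set \<phi> I S} = k}"
proof -
  let ?q = "CARD('k)" and ?s = "V.dim I"
  have qq: "?q ^ (2 * ?s + 1) dvd ?q ^ (?s + 1) * ?q ^ (?s + 1)"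
    unfolding power_add[symmetric] by (rule le_imp_power_dvd) simp
  have dvd_a: "?q ^ (?s + 1) dvd CARD('a)"
  proof -
    have "CARD('a) = ?q ^ V.dim (UNIV :: 'a set)"
      by (rule V.card_subspace) (simp_all add: V.subspace_UNIV)
    moreover have "card base_sum \<le> CARD('a)" by (rule card_mono) auto
    moreover have "1 < ?q" using card_field_ge_2[where 'a = 'k] by simp
    ultimately have "?s + 1 \<le> V.dim (UNIV :: 'a set)"
      unfolding card_base_sum by (metis power_le_imp_le_exp)
    with \<open>CARD('a) = _\<close> show ?thesis by (metis le_imp_power_dvd)
  qed
  have compl: "?q ^ (?s + 1) dvd card (- base_sum)"
    using dvd_a by (simp only: card_complement dvd_diff_nat card_base_sum dvd_refl)
  have card_S: "card S = ?q * t"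
    using card_pairs_eq_sum[of UNIV "\<lambda>x y. (x, y) \<in> S"] fib by simp
  have A: "?q ^ (2 * ?s + 1) dvd card {(m, b). m \<in> base_sum \<and> b \<in> base_sum \<and> card (line_abscissae m b) = k}"
  proof -
    have "?q ^ (2 * ?s + 1) = ?q * (?q ^ ?s * ?q ^ ?s)"
      by (simp add: mult_2 flip: power_add)
    then show ?thesis
      unfolding card_lines_base_sum card_I by (simp only:) (rule mult_dvd_mono[OF dvd dvd_refl])
  qed
  have B: "?q ^ (2 * ?s + 1) dvd card {(m, b). m \<in> base_sum \<and> b \<notin> base_sum \<and> card (line_abscissae m b) = k}"
  proof (cases "k = 0")
    case True
    have "{(m, b). m \<in> base_sum \<and> b \<notin> base_sum \<and> card (line_abscissae m b) = k} = base_sum \<times> (- base_sum)"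
      using True by (auto simp: line_abscissae_outside)
    then have "card {(m, b). m \<in> base_sum \<and> b \<notin> base_sum \<and> card (line_abscissae m b) = k} =
        ?q ^ (?s + 1) * card (- base_sum)"
      by (simp only: card_cartesian_product card_base_sum)
    then show ?thesis
      by (simp only:) (rule dvd_trans[OF qq mult_dvd_mono[OF dvd_refl compl]])
  next
    case False
    then have "{(m, b). m \<in> base_sum \<and> b \<notin> base_sum \<and> card (line_abscissae m b) = k} = {}"
      by (auto simp: line_abscissae_outside)
    then show ?thesis by (simp only: card.empty dvd_0_right)
  qed
  have C: "?q ^ (2 * ?s + 1) dvd card {(m, b). m \<in> - base_sum \<and> card (line_abscissae m b) = k}"
  proof -
    let ?g = "card S * card I"
    define c where "c = (if k = 1 then ?g else if k = 0 then CARD('a) - ?g else 0)"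
    have "card {b. card (line_abscissae m b) = k} = c" if m: "m \<in> - base_sum" for m
    proof -
      obtain G where G: "card G = ?g" "\<And>b. card (line_abscissae m b) = (if b \<in> G then 1 else 0)"
        using card_line_abscissae_steep[of m] m by auto
      have "{b. card (line_abscissae m b) = k} = (if k = 1 then G else if k = 0 then - G else {})"
        unfolding G(2) by auto
      then show ?thesis by (simp add: c_def card_complement G(1))
    qed
    then have eq: "card {(m, b). m \<in> - base_sum \<and> card (line_abscissae m b) = k} = card (- base_sum) * c"
      using card_pairs_eq_sum[of "- base_sum" "\<lambda>m b. card (line_abscissae m b) = k"] by simp
    have "?q ^ (?s + 1) dvd ?g" by (simp add: card_S card_I)
    then have c: "?q ^ (?s + 1) dvd c" using dvd_a by (simp add: c_def dvd_diff_nat)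
    show ?thesis unfolding eq by (rule dvd_trans[OF qq mult_dvd_mono[OF compl c]])
  qed
  let ?P = "\<lambda>p. card (line_abscissae (fst p) (snd p)) = k"
  have "card {p. ?P p} = card {p. ?P p \<and> fst p \<in> base_sum} + card {p. ?P p \<and> fst p \<notin> base_sum}"
    by (rule card_split)
  also have "card {p. ?P p \<and> fst p \<in> base_sum} =
      card {p. (?P p \<and> fst p \<in> base_sum) \<and> snd p \<in> base_sum} + card {p. (?P p \<and> fst p \<in> base_sum) \<and> snd p \<notin> base_sum}"
    by (rule card_split)
  finally have "card {p. ?P p} = card {(m, b). m \<in> base_sum \<and> b \<in> base_sum \<and> card (line_abscissae m b) = k} +
      card {(m, b). m \<in> base_sum \<and> b \<notin> base_sum \<and> card (line_abscissae m b) = k} +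
      card {(m, b). m \<in> - base_sum \<and> card (line_abscissae m b) = k}"
    by (simp add: case_prod_beta' conj_ac)
  then have "?q ^ (2 * ?s + 1) dvd card {p. ?P p}" using A B C by simp
  then show ?thesis by (simp add: card_lifted_line case_prod_beta')
qed

text \<open>
  A vertical line meets the lifted set in \<open>t q^s\<close> points if its abscissa is in \<open>GF(q)\<close>, and in none
  otherwise.  The coefficient of \<open>x^(t q^(s+1))\<close> thus obtained differs from the stated one by \<open>q^(2h)\<close>,
  which is \<open>0\<close> for the modulus because \<open>GF(q) \<oplus> I\<close> is contained in the field, so that \<open>s + 1 \<le> h\<close>.
\<close>

lemma lifted_weight_enumerator_cong:
  assumes card_k: "CARD('k) = q" and card_a: "CARD('a) = q ^ h"
    and reg: "regular_pointed_at point_infinity line_infinity t ms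
      (insert point_infinity (affine_point ` S))"
    and s: "V.dim I = s"
    and C: "is_projective_code (insert point_infinity (affine_point ` lifted_set \<phi> I S)) C"
  shows "poly_cong (int (q ^ (2 * s + 1)))
    (weight_enumerator (card (insert point_infinity (affine_point ` lifted_set \<phi> I S))) C)
    (1 + monom (int (q ^ (h + 1)) - int q) (t * q ^ s * (q - 1))
       + monom (- int (q ^ (h + 1)) + int q - 1) (t * q ^ (s + 1)))"
proof -
  let ?L = "lifted_set \<phi> I S" and ?Y = "insert point_infinity (affine_point ` S)"
  have t: "t > 0" using reg by (simp add: regular_pointed_at_def)
  have q2: "q \<ge> 2" using card_field_ge_2[where 'a = 'k] card_k by simp
  have fib: "card {y. (x, y) \<in> S} = t" for x
  proof -
    have "is_secant (t + 1) ?Y (vertical_line x)"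
      using reg line_infinity_neq_vertical[of x] unfolding regular_pointed_at_def
      by (metis incidence_simps(5) lines_in_pg_lines(2))
    then show ?thesis unfolding is_secant_def card_vertical_line_Int by simp
  qed
  have dvd_S: "CARD('k) dvd card {(m, b). card {x. (x, m * x + b) \<in> S} = k}" for k
    using regular_pointed_dvd_card_secants[OF reg] unfolding card_lines_avoiding_infinity .
  have dvd: "q ^ (2 * s + 1) dvd card {(m, b). card {z. (z, m * z + b) \<in> ?L} = k}" for k
    using dvd_card_lifted_lines[OF fib dvd_S] unfolding card_k s .
  have fibL: "card {w. (\<phi> x, w) \<in> ?L} = t * q ^ s" for x
    by (simp add: card_lifted_fibre fib card_I card_k s)
  have fibL0: "card {w. (a, w) \<in> ?L} = 0" if "a \<notin> range \<phi>" for a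
    using that lifted_set_abscissa by auto
  have card_range: "card (range \<phi>) = q" by (simp add: card_image[OF inj_emb] card_k)
  have "card ?L = (\<Sum>a\<in>UNIV. card {w. (a, w) \<in> ?L})"
    using card_pairs_eq_sum[of UNIV "\<lambda>a w. (a, w) \<in> ?L"] by simp
  also have "\<dots> = (\<Sum>a\<in>range \<phi>. t * q ^ s)"
    by (rule sum.mono_neutral_cong_right) (auto simp: fibL fibL0)
  finally have card_L: "card ?L = t * q ^ (s + 1)" by (simp add: card_range)
  have ex: "\<exists>w. (\<phi> x, w) \<in> ?L" for x
  proof (rule ccontr)
    assume "\<nexists>w. (\<phi> x, w) \<in> ?L"
    then have "card {w. (\<phi> x, w) \<in> ?L} = 0" by simp
    then show False using fibL[of x] t q2 by simp
  qed
  obtain w0 where w0: "(\<phi> 0, w0) \<in> ?L" using ex[of 0] by (rule exE)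
  obtain w1 where w1: "(\<phi> 1, w1) \<in> ?L" using ex[of 1] by (rule exE)
  have neq: "\<phi> 0 \<noteq> \<phi> 1" by (simp add: emb_simps)
  let ?n = "t * q ^ (s + 1)" and ?r = "t * q ^ s * (q - 1)"
  have "(\<Sum>a\<in>UNIV. monom 1 (card ?L - card {w. (a, w) \<in> ?L})) =
      (\<Sum>a\<in>range \<phi>. monom (1::int) ?r) + (\<Sum>a\<in>- range \<phi>. monom 1 ?n)"
  proof -
    have "(\<Sum>a\<in>UNIV. monom (1::int) (card ?L - card {w. (a, w) \<in> ?L})) =
        (\<Sum>a\<in>range \<phi>. monom 1 (card ?L - card {w. (a, w) \<in> ?L})) +
        (\<Sum>a\<in>- range \<phi>. monom 1 (card ?L - card {w. (a, w) \<in> ?L}))"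
      by (rule sum.union_disjoint[of "range \<phi>" "- range \<phi>", simplified Compl_partition]) auto
    moreover have "card ?L - t * q ^ s = ?r" by (simp add: card_L algebra_simps)
    ultimately show ?thesis
      by (auto simp: fibL fibL0 card_L simp del: sum_constant
          intro!: arg_cong2[of _ _ _ _ "(+)"] sum.cong)
  qed
  also have "\<dots> = monom (int q) ?r + monom (int (q ^ h) - int q) ?n"
  proof -
    have "q \<le> q ^ h" using card_mono[of "UNIV :: 'a set" "range \<phi>"] card_range card_a by simp
    then have "int (card (- range \<phi>)) = int (q ^ h) - int q"
      by (simp add: card_complement card_range card_a of_nat_diff)
    then show ?thesis unfolding sum_monom_const card_range by simp
  qed
  finally have verticals: "(\<Sum>a\<in>UNIV. monom 1 (card ?L - card {w. (a, w) \<in> ?L})) =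
      monom (int q) ?r + monom (int (q ^ h) - int q) ?n" .
  have "poly_cong (int (q ^ (2 * s + 1)))
    (weight_enumerator (card (insert point_infinity (affine_point ` ?L))) C)
    (1 + smult (int (q ^ h) - 1) (monom 1 ?n + (monom (int q) ?r + monom (int (q ^ h) - int q) ?n)))"
    using weight_enumerator_affine_cong[OF C w0 w1 neq dvd] unfolding verticals[unfolded card_L] card_L card_a .
  moreover have "poly_cong (int (q ^ (2 * s + 1)))
    (1 + smult (int (q ^ h) - 1) (monom 1 ?n + (monom (int q) ?r + monom (int (q ^ h) - int q) ?n)))
    (1 + monom (int (q ^ (h + 1)) - int q) ?r + monom (- int (q ^ (h + 1)) + int q - 1) ?n)"
  proof -
    have "1 + smult (int (q ^ h) - 1) (monom 1 ?n + (monom (int q) ?r + monom (int (q ^ h) - int q) ?n)) -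
      (1 + monom (int (q ^ (h + 1)) - int q) ?r + monom (- int (q ^ (h + 1)) + int q - 1) ?n) =
      monom (int (q ^ h * q ^ h)) ?n"
      by (simp add: poly_eq_iff algebra_simps)
    moreover have "q ^ (2 * s + 1) dvd q ^ h * q ^ h"
    proof -
      have "q ^ (s + 1) \<le> q ^ h"
        using card_mono[of "UNIV :: 'a set" base_sum] by (simp add: card_base_sum card_k s card_a)
      then have "s + 1 \<le> h" using q2 by (metis power_le_imp_le_exp Suc_1 Suc_le_eq)
      then show ?thesis unfolding power_add[symmetric] by (intro le_imp_power_dvd) simp
    qed
    then have "[:int (q ^ (2 * s + 1)):] dvd monom (int (q ^ h * q ^ h)) ?n"
      unfolding const_poly_dvd_iff coeff_monom by (simp only: of_nat_dvd_iff split: if_splits) simp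
    ultimately show ?thesis unfolding poly_cong_iff_dvd by (simp only:)
  qed
  ultimately show ?thesis by (rule poly_cong_trans)
qed

end

section \<open>The weight enumerators\<close>

theorem proposition4p2:
  fixes q h :: nat
  assumes "primepow q" and "h > 0"
    and "CARD('a::{field,finite}) = q ^ h"
  shows
    "(\<forall>(X :: ('a ^ 3) set set) C.
        regular_pointed X \<and> is_projective_code X C \<longrightarrow>
        weight_enumerator (card X) C =
          1 + smult (int (q ^ h) - 1)
                (\<Sum>i\<le>card X. monom (coeff (intersection_enumerator X) i) (card X - i)) \<and>
        poly_cong (int (q ^ h)) (weight_enumerator (card X) C) (1 - monom 1 (card X - 1)))
     \<and>
     (\<forall>(f :: 'a \<Rightarrow> 'a) X C.
        h = 2 \<and> Modules.additive f \<and> X = curve_points q f \<and> is_projective_code X C \<longrightarrow>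
        poly_cong (int (q ^ 3)) (weight_enumerator (card X) C)
          (1 - monom (int (q ^ 2)) (q ^ 3 - q) + monom (int (q ^ 2) - 1) (q ^ 3)))
     \<and>
     (\<forall>(\<phi> :: 'k::{field,finite} \<Rightarrow> 'a) S t ms (I :: 'a set) s X C.
        CARD('k) = q \<and> is_field_embedding \<phi> \<and>
        regular_pointed_at point_infinity line_infinity t ms
          (insert point_infinity (affine_point ` S)) \<and>
        module.subspace (\<lambda>c x. \<phi> c * x) I \<and> I \<noteq> {0} \<and>
        vector_space.dim (\<lambda>c x. \<phi> c * x) I = s \<and>
        I \<inter> range \<phi> = {0} \<and>
        X = insert point_infinity (affine_point ` lifted_set \<phi> I S) \<and>
        is_projective_code X C \<longrightarrow>
        poly_cong (int (q ^ (2 * s + 1))) (weight_enumerator (card X) C)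
          (1 + monom (int (q ^ (h + 1)) - int q) (t * q ^ s * (q - 1))
             + monom (- int (q ^ (h + 1)) + int q - 1) (t * q ^ (s + 1))))"
proof (intro conjI allI impI)
  fix X :: "('a ^ 3) set set" and C
  assume "regular_pointed X \<and> is_projective_code X C"
  then obtain P0 l0 t ms where reg: "regular_pointed_at P0 l0 t ms X" and C: "is_projective_code X C"
    by (auto simp: regular_pointed_def)
  have X: "X \<subseteq> pg_points" using reg by (simp add: regular_pointed_at_def)
  show "weight_enumerator (card X) C = 1 + smult (int (q ^ h) - 1)
      (\<Sum>i\<le>card X. monom (coeff (intersection_enumerator X) i) (card X - i))"
    unfolding sum_intersection_enumerator assms(3)[symmetric]
    by (rule weight_enumerator_eq[OF X regular_pointed_not_in_line[OF reg] C])
  show "poly_cong (int (q ^ h)) (weight_enumerator (card X) C) (1 - monom 1 (card X - 1))"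
    using regular_pointed_weight_enumerator_cong[OF reg C] unfolding assms(3) .
next
  fix f :: "'a \<Rightarrow> 'a" and X C
  assume "h = 2 \<and> Modules.additive f \<and> X = curve_points q f \<and> is_projective_code X C"
  then have "CARD('a) = q ^ 2" "Modules.additive f" "X = curve_points q f"
      "is_projective_code (curve_points q f) C"
    using assms(3) by auto
  then show "poly_cong (int (q ^ 3)) (weight_enumerator (card X) C)
      (1 - monom (int (q ^ 2)) (q ^ 3 - q) + monom (int (q ^ 2) - 1) (q ^ 3))"
    using curve_weight_enumerator_cong[OF assms(1)] by simp
next
  fix \<phi> :: "'k \<Rightarrow> 'a" and S t ms and I :: "'a set" and s X C
  assume *: "CARD('k) = q \<and> is_field_embedding \<phi> \<and>
        regular_pointed_at point_infinity line_infinity t ms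
          (insert point_infinity (affine_point ` S)) \<and>
        module.subspace (\<lambda>c x. \<phi> c * x) I \<and> I \<noteq> {0} \<and>
        vector_space.dim (\<lambda>c x. \<phi> c * x) I = s \<and>
        I \<inter> range \<phi> = {0} \<and>
        X = insert point_infinity (affine_point ` lifted_set \<phi> I S) \<and>
        is_projective_code X C"
  then have X: "X = insert point_infinity (affine_point ` lifted_set \<phi> I S)" by blast
  show "poly_cong (int (q ^ (2 * s + 1))) (weight_enumerator (card X) C)
          (1 + monom (int (q ^ (h + 1)) - int q) (t * q ^ s * (q - 1))
             + monom (- int (q ^ (h + 1)) + int q - 1) (t * q ^ (s + 1)))"
    unfolding X by (rule lifted_weight_enumerator_cong[where ms = ms]) (use * assms(3) in auto)
qed

end
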